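(* Let $\alpha,\beta,\gamma$ be real constants with $\alpha,\gamma<0$, and let $(u_0,v_0)\in H^1(\mathbb{R})\times H^1(\mathbb{R})$. Let $(u,v)$ be the corresponding global solution, with initial condition $(u_0,v_0)$, of the Schrödinger–Korteweg–de Vries system $$\begin{cases} i\partial_t u+\partial_x^2 u=\alpha uv+\beta u|u|^2,\\ \partial_t v+\partial_x^3 v+v\,\partial_x v=\gamma\,\partial_x(|u|^2),\\ u(x,0)=u_0(x),\quad v(x,0)=v_0(x).\end{cases}$$ Let $0<p_1<\frac23$, let $C>0$ be any constant, and set $\Omega_{p_1}(t)=\{x\in\mathbb{R} : |x|\le C\,t^{p_1}\}$. Then $$\liminf_{t\uparrow\infty}\int_{\Omega_{p_1}(t)} v^2(t,x)\,\mathrm{d}x=\liminf_{t\uparrow\infty}\int_{\Omega_{p_1}(t)}|u|^2(t,x)\,\mathrm{d}x=0.$$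
   Context: Here $x\in\mathbb{R}$ is the space variable, $t$ is time, $u$ is complex-valued and $v$ is real-valued; $u(t,x)$ and $u(x,t)$ denote the same value. Spaces: for $k,s\in\mathbb{R}$ and $b\in(0,1)$, $X^{k,b}$ and $Y^{s,b}$ are the completions of the Schwartz space $\mathcal{S}(\mathbb{R}^2)$ under the norms $$\|f\|_{X^{k,b}}=\Big(\iint\langle\xi\rangle^{2k}\langle\tau+\xi^2\rangle^{2b}|\widehat f(\xi,\tau)|^2\,d\tau\,d\xi\Big)^{1/2},\qquad \|f\|_{Y^{s,b}}=\Big(\iint\langle\xi\rangle^{2s}\langle\tau-\xi^3\rangle^{2b}|\widehat f(\xi,\tau)|^2\,d\tau\,d\xi\Big)^{1/2},$$ where $\langle y\rangle=(1+|y|^2)^{1/2}$ and $\widehat f$ is the Fourier transform in the variables $x,t$. Solution: it is known (Corcho–Linares) that for $(u_0,v_0)\in H^1(\mathbb{R})\times H^1(\mathbb{R})$ there are $T>0$ and a unique solution $(u,v)$ on $[0,T]$ with $u,v\in C([0,T];H^1(\mathbb{R}))$ such that, after multiplication by a smooth time cutoff equal to $1$ on $[0,T]$, $u\in X^{1,b}$ and $v\in Y^{1,b}$ for some $b>\frac12$ close to $\frac12$; the solution depends locally Lipschitz-continuously on the data. If moreover $\alpha\gamma>0$, this solution extends to all $T>0$ and satisfies $\sup_{t}\big(\|u(t)\|_{H^1}+\|v(t)\|_{H^1}\big)\le\Psi(\|u_0\|_{H^1},\|v_0\|_{H^1})$ for a function $\Psi$ depending only on the two norms. "The corresponding solution"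 means this global solution. *)

theory Defs
  imports "HOL-Analysis.Analysis"
begin

section \<open>Smooth functions, test functions, Schwartz functions\<close>

text \<open>
  \<open>C\<^sup>\<infinity>\<close> as the largest class of everywhere Frechet differentiable functions that is closed
  under directional derivatives, i.e. all iterated directional derivatives (in any order)
  exist and are differentiable.
\<close>

coinductive smooth_fun :: "('a::euclidean_space \<Rightarrow> 'b::real_normed_vector) \<Rightarrow> bool" where
  "\<lbrakk>\<forall>z. f differentiable (at z);
    \<forall>h. smooth_fun (\<lambda>z. frechet_derivative f (at z) h)\<rbrakk> \<Longrightarrow> smooth_fun f"

definition test_fun :: "'a::euclidean_space set \<Rightarrow> ('a \<Rightarrow> real) \<Rightarrow> bool" where
  "test_fun S \<phi> \<longleftrightarrow>
     smooth_fun \<phi> \<and> compact (closure {z. \<phi> z \<noteq> 0}) \<and> closure {z. \<phi> z \<noteq> 0} \<subseteq> S"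

text \<open>In the same way: every iterated directional derivative is rapidly decreasing.\<close>

coinductive schwartz_fun :: "('a::euclidean_space \<Rightarrow> 'b::real_normed_vector) \<Rightarrow> bool" where
  "\<lbrakk>\<forall>z. f differentiable (at z);
    \<forall>n::nat. bounded (range (\<lambda>z. norm z ^ n *\<^sub>R f z));
    \<forall>h. schwartz_fun (\<lambda>z. frechet_derivative f (at z) h)\<rbrakk> \<Longrightarrow> schwartz_fun f"

text \<open>Points of the plane are pairs \<open>(x, t)\<close>, space first.\<close>

definition Dx :: "(real \<times> real \<Rightarrow> real) \<Rightarrow> real \<times> real \<Rightarrow> real" where
  "Dx \<Phi> = (\<lambda>z. frechet_derivative \<Phi> (at z) (1, 0))"

definition Dt :: "(real \<times> real \<Rightarrow> real) \<Rightarrow> real \<times> real \<Rightarrow> real" where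
  "Dt \<Phi> = (\<lambda>z. frechet_derivative \<Phi> (at z) (0, 1))"

section \<open>The Sobolev space \<open>H\<^sup>1(\<real>)\<close>\<close>

text \<open>
  Elements are represented by functions, two functions being the same element if they agree
  almost everywhere.
\<close>

definition L2 :: "(real \<Rightarrow> 'b::euclidean_space) set" where
  "L2 = {f. f \<in> borel_measurable lborel \<and> integrable lborel (\<lambda>x. (norm (f x))\<^sup>2)}"

definition has_weak_deriv_L2 ::
    "(real \<Rightarrow> 'b::euclidean_space) \<Rightarrow> (real \<Rightarrow> 'b) \<Rightarrow> bool" where
  "has_weak_deriv_L2 f g \<longleftrightarrow> g \<in> L2 \<and>
     (\<forall>\<phi>. test_fun UNIV \<phi> \<longrightarrow>
        (LINT x|lborel. deriv \<phi> x *\<^sub>R f x) = - (LINT x|lborel. \<phi> x *\<^sub>R g x))"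

definition H1 :: "(real \<Rightarrow> 'b::euclidean_space) set" where
  "H1 = {f \<in> L2. \<exists>g. has_weak_deriv_L2 f g}"

text \<open>The choice of the weak derivative is immaterial, as it is unique up to null sets.\<close>

definition weak_deriv :: "(real \<Rightarrow> 'b::euclidean_space) \<Rightarrow> real \<Rightarrow> 'b" where
  "weak_deriv f = (SOME g. has_weak_deriv_L2 f g)"

definition H1_norm :: "(real \<Rightarrow> 'b::euclidean_space) \<Rightarrow> real" where
  "H1_norm f =
     sqrt ((LINT x|lborel. (norm (f x))\<^sup>2) + (LINT x|lborel. (norm (weak_deriv f x))\<^sup>2))"

definition continuous_into_H1 :: "real set \<Rightarrow> (real \<Rightarrow> real \<Rightarrow> 'b::euclidean_space) \<Rightarrow> bool" where
  "continuous_into_H1 I w \<longleftrightarrow> (\<forall>t\<in>I. w t \<in> H1) \<and>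
     (\<forall>s\<in>I. ((\<lambda>t. H1_norm (\<lambda>x. w t x - w s x)) \<longlongrightarrow> 0) (at s within I))"

section \<open>The Bourgain spaces \<open>X\<^sup>k\<^sup>,\<^sup>b\<close> and \<open>Y\<^sup>s\<^sup>,\<^sup>b\<close>\<close>

definition japanese :: "real \<Rightarrow> real" where
  "japanese y = sqrt (1 + \<bar>y\<bar>\<^sup>2)"

text \<open>
  The sign in the exponent matters: with \<open>exp (- \<i> (x \<xi> + t \<tau>))\<close> the free Schroedinger and Airy
  flows live on \<open>\<tau> + \<xi>\<^sup>2 = 0\<close> and \<open>\<tau> - \<xi>\<^sup>3 = 0\<close>.  A different normalising constant would only
  rescale the norms below.
\<close>

definition fourier2 :: "(real \<times> real \<Rightarrow> complex) \<Rightarrow> real \<times> real \<Rightarrow> complex" where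
  "fourier2 f \<zeta> = (LINT z|lborel. cis (- (z \<bullet> \<zeta>)) * f z)"

definition X_norm :: "real \<Rightarrow> real \<Rightarrow> (real \<times> real \<Rightarrow> complex) \<Rightarrow> real" where
  "X_norm k b f = sqrt (LINT (\<xi>, \<tau>)|lborel.
     japanese \<xi> powr (2 * k) * japanese (\<tau> + \<xi>^2) powr (2 * b) * (cmod (fourier2 f (\<xi>, \<tau>)))\<^sup>2)"

definition Y_norm :: "real \<Rightarrow> real \<Rightarrow> (real \<times> real \<Rightarrow> complex) \<Rightarrow> real" where
  "Y_norm s b f = sqrt (LINT (\<xi>, \<tau>)|lborel.
     japanese \<xi> powr (2 * s) * japanese (\<tau> - \<xi>^3) powr (2 * b) * (cmod (fourier2 f (\<xi>, \<tau>)))\<^sup>2)"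

text \<open>
  The completion of the Schwartz space under a norm \<open>N\<close>, realised inside the tempered
  distributions: a function belongs to it if it is the distributional limit of an \<open>N\<close>-Cauchy
  sequence of Schwartz functions.  For the two norms above and nonnegative exponents \<open>N\<close>
  dominates the \<open>L\<^sup>2\<close> norm, so that every element of the completion is a function.
\<close>

definition schwartz_completion ::
    "((real \<times> real \<Rightarrow> complex) \<Rightarrow> real) \<Rightarrow> (real \<times> real \<Rightarrow> complex) set" where
  "schwartz_completion N = {f.
     (\<forall>\<Phi>::real \<times> real \<Rightarrow> complex. schwartz_fun \<Phi> \<longrightarrow> integrable lborel (\<lambda>z. f z * \<Phi> z)) \<and>
     (\<exists>F. (\<forall>n::nat. schwartz_fun (F n)) \<and>
          (\<forall>e>0. \<exists>M. \<forall>m\<ge>M. \<forall>n\<ge>M. N (\<lambda>z. F m z - F n z) < e) \<and>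
          (\<forall>\<Phi>. schwartz_fun \<Phi> \<longrightarrow>
             (\<lambda>n. LINT z|lborel. F n z * \<Phi> z) \<longlonglongrightarrow> (LINT z|lborel. f z * \<Phi> z)))}"

definition X_space :: "real \<Rightarrow> real \<Rightarrow> (real \<times> real \<Rightarrow> complex) set" where
  "X_space k b = schwartz_completion (X_norm k b)"

definition Y_space :: "real \<Rightarrow> real \<Rightarrow> (real \<times> real \<Rightarrow> complex) set" where
  "Y_space s b = schwartz_completion (Y_norm s b)"

text \<open>
  Membership on \<open>[0, T]\<close> after multiplication by a smooth time cutoff.  As a cutoff does not vanish
  right of \<open>T\<close> and left of \<open>0\<close>, the function is first extended beyond \<open>[0, T]\<close>.
\<close>

definition in_after_cutoff ::
    "real \<Rightarrow> (real \<times> real \<Rightarrow> complex) set \<Rightarrow> (real \<Rightarrow> real \<Rightarrow> complex) \<Rightarrow> bool" where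
  "in_after_cutoff T Z w \<longleftrightarrow> (\<exists>\<theta> W.
     test_fun UNIV \<theta> \<and> (\<forall>t\<in>{0..T}. \<theta> t = 1) \<and>
     (\<forall>t\<in>{0..T}. AE x in lborel. W (x, t) = w t x) \<and>
     (\<lambda>(x, t). \<theta> t *\<^sub>R W (x, t)) \<in> Z)"

section \<open>The Schroedinger--Korteweg--de Vries system\<close>

text \<open>
  The equations hold in the sense of distributions on \<open>\<real> \<times> (0,\<infinity>)\<close>, with \<open>v \<partial>\<^sub>x v\<close> read as
  \<open>\<partial>\<^sub>x (v\<^sup>2/2)\<close>.  Real test functions suffice by linearity.  Iterated integrals are used because the
  inner ones do not depend on the choice of representatives of \<open>u t\<close> and \<open>v t\<close>.
\<close>

definition schroedinger_eq ::
    "real \<Rightarrow> real \<Rightarrow> (real \<Rightarrow> real \<Rightarrow> complex) \<Rightarrow> (real \<Rightarrow> real \<Rightarrow> real) \<Rightarrow> bool" where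
  "schroedinger_eq \<alpha> \<beta> u v \<longleftrightarrow> (\<forall>\<Phi>. test_fun (UNIV \<times> {0<..}) \<Phi> \<longrightarrow>
     (LINT t|lborel. LINT x|lborel.
        - (Dt \<Phi> (x, t) *\<^sub>R (\<i> * u t x)) + Dx (Dx \<Phi>) (x, t) *\<^sub>R u t x) =
     (LINT t|lborel. LINT x|lborel. \<Phi> (x, t) *\<^sub>R
        (of_real \<alpha> * u t x * of_real (v t x) + of_real \<beta> * u t x * of_real ((cmod (u t x))\<^sup>2))))"

definition kdv_eq ::
    "real \<Rightarrow> (real \<Rightarrow> real \<Rightarrow> complex) \<Rightarrow> (real \<Rightarrow> real \<Rightarrow> real) \<Rightarrow> bool" where
  "kdv_eq \<gamma> u v \<longleftrightarrow> (\<forall>\<Phi>. test_fun (UNIV \<times> {0<..}) \<Phi> \<longrightarrow>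
     (LINT t|lborel. LINT x|lborel.
        - (Dt \<Phi> (x, t) * v t x) - Dx (Dx (Dx \<Phi>)) (x, t) * v t x
        - Dx \<Phi> (x, t) * ((v t x)\<^sup>2 / 2)) =
     (LINT t|lborel. LINT x|lborel. - (Dx \<Phi> (x, t) * (\<gamma> * (cmod (u t x))\<^sup>2))))"

text \<open>
  The global solution provided by the well-posedness theory of Corcho and Linares.  The last
  clause is their a priori bound (for fixed data \<open>M\<close> is the number
  \<open>\<Psi> (H1_norm u0) (H1_norm v0)\<close>), which comes with the solution when \<open>\<alpha> \<gamma> > 0\<close>.
\<close>

definition global_solution ::
    "real \<Rightarrow> real \<Rightarrow> real \<Rightarrow> (real \<Rightarrow> complex) \<Rightarrow> (real \<Rightarrow> real) \<Rightarrow>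
     (real \<Rightarrow> real \<Rightarrow> complex) \<Rightarrow> (real \<Rightarrow> real \<Rightarrow> real) \<Rightarrow> bool" where
  "global_solution \<alpha> \<beta> \<gamma> u0 v0 u v \<longleftrightarrow>
     continuous_into_H1 {0..} u \<and> continuous_into_H1 {0..} v \<and>
     (AE x in lborel. u 0 x = u0 x) \<and> (AE x in lborel. v 0 x = v0 x) \<and>
     schroedinger_eq \<alpha> \<beta> u v \<and> kdv_eq \<gamma> u v \<and>
     (\<forall>T>0. \<exists>b. 1/2 < b \<and> b < 1 \<and>
        in_after_cutoff T (X_space 1 b) u \<and>
        in_after_cutoff T (Y_space 1 b) (\<lambda>t x. of_real (v t x))) \<and>
     (\<exists>M. \<forall>t\<ge>0. H1_norm (u t) + H1_norm (v t) \<le> M)"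

definition Omega :: "real \<Rightarrow> real \<Rightarrow> real \<Rightarrow> real set" where
  "Omega C p t = {x. \<bar>x\<bar> \<le> C * t powr p}"

end

theory Submission
  imports Defs
begin

text \<open>
  The argument rests on the KdV equation of the system, written as a conservation law for \<open>v\<close> with
  flux \<open>\<partial>\<^sub>x\<^sup>2 v + v\<^sup>2/2 - \<gamma> \<bar>u\<bar>\<^sup>2\<close>.  Because \<open>\<gamma> < 0\<close>, the nonlinear part of the flux is nonnegative and
  dominates \<open>v\<^sup>2\<close> and \<open>\<bar>u\<bar>\<^sup>2\<close> separately.  Hence both claims follow if the integral of the flux over the
  window \<open>\<Omega>(t)\<close> cannot stay above a constant \<open>\<delta> > 0\<close> for all large times.

  Suppose it does.  The derivative of \<open>\<integral> w v dx\<close> is \<open>\<integral> w' (v\<^sup>2/2 - \<gamma> \<bar>u\<bar>\<^sup>2) dx + \<integral> w''' v dx\<close>.  Take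
  \<open>w(x) = W(x / l)\<close> with \<open>l = C (2 T)\<^sup>p\<close> and \<open>W\<close> smooth, compactly supported, with derivative at least
  \<open>1 - \<epsilon>\<close> on \<open>[-1, 1]\<close> and at least \<open>- \<epsilon>\<close> everywhere (lemma \<open>slowly_decreasing_cutoff\<close>).  As the
  total flux is bounded by the a priori bound, a small \<open>\<epsilon>\<close> makes the first term at least
  \<open>\<delta> / (2 l)\<close> throughout \<open>[T, 2 T]\<close>.  On the other hand \<open>\<integral> w v dx\<close> is \<open>O(l^(1/2))\<close> by the
  Cauchy--Schwarz inequality, and the dispersive term is \<open>O(l^(-5/2))\<close>.  Integrating over \<open>[T, 2 T]\<close>
  gives \<open>1 \<le> K (l^(3/2) / T + l^(-3/2))\<close> with \<open>K\<close> depending on \<open>\<delta>\<close> but not on \<open>T\<close>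
  (lemma \<open>persistent_flux_bound\<close>), which fails for large \<open>T\<close> since \<open>0 < p < 2/3\<close>.

  As the equation holds in the sense of distributions, the integration in time is done with a smooth
  cutoff \<open>\<theta>(t / T)\<close> (lemma \<open>virial_identity\<close>).  The \<open>H\<^sup>1\<close> continuity of the solution in time
  makes the resulting time integrals converge.
\<close>

section \<open>Smooth functions and a bump\<close>

lemma smooth_fun_differentiable:
  assumes "smooth_fun f"
  shows "f differentiable (at z)"
  using assms by (cases rule: smooth_fun.cases) blast

lemma smooth_fun_frechet_derivative:
  assumes "smooth_fun f"
  shows "smooth_fun (\<lambda>z. frechet_derivative f (at z) h)"
  using assms by (cases rule: smooth_fun.cases) blast

text \<open>
  The inductive closure serves as the coinduction invariant: the derivative of a product is a sum
  of products, so products alone are not closed under directional derivatives, while this algebra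
  is.
\<close>

inductive smooth_algebra :: "('a::euclidean_space \<Rightarrow> real) \<Rightarrow> bool" where
  base: "smooth_fun f \<Longrightarrow> smooth_algebra f"
| add: "smooth_algebra f \<Longrightarrow> smooth_algebra g \<Longrightarrow> smooth_algebra (\<lambda>z. f z + g z)"
| mult: "smooth_algebra f \<Longrightarrow> smooth_algebra g \<Longrightarrow> smooth_algebra (\<lambda>z. f z * g z)"

lemma smooth_algebra_differentiable:
  assumes "smooth_algebra f"
  shows "f differentiable (at z)"
  using assms by induction (auto intro: smooth_fun_differentiable)

lemma smooth_algebra_frechet_derivative:
  assumes "smooth_algebra f"
  shows "smooth_algebra (\<lambda>z. frechet_derivative f (at z) h)"
  using assms
proof induction
  case (base f)
  then show ?case by (intro smooth_algebra.base smooth_fun_frechet_derivative)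
next
  case (add f g)
  have "frechet_derivative (\<lambda>z. f z + g z) (at z) h =
      frechet_derivative f (at z) h + frechet_derivative g (at z) h" for z
  proof -
    have "((\<lambda>z. f z + g z) has_derivative
        (\<lambda>h. frechet_derivative f (at z) h + frechet_derivative g (at z) h)) (at z)"
      using add.hyps[THEN smooth_algebra_differentiable, of z]
      by (intro has_derivative_add) (simp_all add: frechet_derivative_works[symmetric])
    from fun_cong[OF frechet_derivative_at[OF this], of h] show ?thesis by (rule sym)
  qed
  then show ?case
    by (simp only:) (rule smooth_algebra.add[OF add.IH])
next
  case (mult f g)
  have "frechet_derivative (\<lambda>z. f z * g z) (at z) h =
      f z * frechet_derivative g (at z) h + frechet_derivative f (at z) h * g z" for z
  proof -
    have "((\<lambda>z. f z * g z) has_derivative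
        (\<lambda>h. f z * frechet_derivative g (at z) h + frechet_derivative f (at z) h * g z)) (at z)"
      using mult.hyps[THEN smooth_algebra_differentiable, of z]
      by (intro has_derivative_mult) (simp_all add: frechet_derivative_works[symmetric])
    from fun_cong[OF frechet_derivative_at[OF this], of h] show ?thesis by (rule sym)
  qed
  then show ?case
    by (simp only:) (intro smooth_algebra.add smooth_algebra.mult mult.hyps mult.IH)
qed

lemma smooth_algebra_imp_smooth_fun:
  assumes "smooth_algebra f"
  shows "smooth_fun f"
  using assms
proof (coinduction arbitrary: f)
  case smooth_fun
  then show ?case
    using smooth_algebra_differentiable[OF smooth_fun]
      smooth_algebra_frechet_derivative[OF smooth_fun] by blast
qed

lemma smooth_fun_add:
  fixes f g :: "'a::euclidean_space \<Rightarrow> real"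
  assumes "smooth_fun f" "smooth_fun g"
  shows "smooth_fun (\<lambda>z. f z + g z)"
  using smooth_algebra_imp_smooth_fun[OF smooth_algebra.add[OF assms[THEN smooth_algebra.base]]] .

lemma smooth_fun_mult:
  fixes f g :: "'a::euclidean_space \<Rightarrow> real"
  assumes "smooth_fun f" "smooth_fun g"
  shows "smooth_fun (\<lambda>z. f z * g z)"
  using smooth_algebra_imp_smooth_fun[OF smooth_algebra.mult[OF assms[THEN smooth_algebra.base]]] .

lemma smooth_fun_const: "smooth_fun (\<lambda>z::'a::euclidean_space. c::real)"
  by (coinduction arbitrary: c) auto

lemma smooth_fun_affine_compose:
  fixes A :: "'a::euclidean_space \<Rightarrow> 'b::euclidean_space"
  assumes "smooth_fun f" "bounded_linear A"
  shows "smooth_fun (\<lambda>z. f (A z + c))"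
  using assms(1)
proof (coinduction arbitrary: f)
  case (smooth_fun f)
  have der: "((\<lambda>z. f (A z + c)) has_derivative
      (\<lambda>h. frechet_derivative f (at (A z + c)) (A h))) (at z)" for z
  proof -
    have "((\<lambda>z. A z + c) has_derivative A) (at z)"
      using bounded_linear_imp_has_derivative[OF assms(2), of "at z"]
      by (auto intro!: derivative_eq_intros)
    moreover have "(f has_derivative frechet_derivative f (at (A z + c))) (at (A z + c))"
      using smooth_fun_differentiable[OF smooth_fun] by (simp add: frechet_derivative_works[symmetric])
    ultimately show ?thesis
      using has_derivative_compose by blast
  qed
  have "(\<lambda>z. f (A z + c)) differentiable at z" for z
    using der differentiable_def by blast
  moreover have "(\<lambda>z. frechet_derivative (\<lambda>z. f (A z + c)) (at z) h) =
      (\<lambda>z. (\<lambda>y. frechet_derivative f (at y) (A h)) (A z + c))" for h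
    by (rule ext) (rule fun_cong[OF frechet_derivative_at[OF der], symmetric])
  ultimately show ?case
    using smooth_fun_frechet_derivative[OF smooth_fun]
    by (intro exI[of _ "\<lambda>z. f (A z + c)"] conjI allI disjI1 refl) auto
qed

lemma frechet_derivative_real:
  fixes f :: "real \<Rightarrow> real"
  assumes "(f has_real_derivative f') (at x)"
  shows "frechet_derivative f (at x) h = h * f'"
proof -
  have "(f has_derivative (*) f') (at x)"
    using assms by (simp add: has_field_derivative_def)
  from fun_cong[OF frechet_derivative_at[OF this], of h] show ?thesis
    by (simp add: mult.commute)
qed

lemma smooth_fun_has_derivative:
  fixes f :: "real \<Rightarrow> real"
  assumes "smooth_fun f"
  shows "(f has_real_derivative deriv f x) (at x)"
  using smooth_fun_differentiable[OF assms]
  by (simp add: DERIV_deriv_iff_real_differentiable)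

lemma smooth_fun_deriv:
  fixes f :: "real \<Rightarrow> real"
  assumes "smooth_fun f"
  shows "smooth_fun (deriv f)"
  using smooth_fun_frechet_derivative[OF assms, of 1]
    frechet_derivative_real[OF smooth_fun_has_derivative[OF assms], of _ 1]
  by simp

lemma smooth_fun_primitive:
  fixes f g :: "real \<Rightarrow> real"
  assumes "\<And>x. (f has_real_derivative g x) (at x)" "smooth_fun g"
  shows "smooth_fun f"
proof (rule smooth_fun.intros; safe)
  fix x h
  show "f differentiable at x"
    using assms(1) real_differentiable_def by blast
  have "(\<lambda>z. frechet_derivative f (at z) h) = (\<lambda>z. h * g z)"
    using frechet_derivative_real[OF assms(1)] by blast
  then show "smooth_fun (\<lambda>z. frechet_derivative f (at z) h)"
    using smooth_fun_mult[OF smooth_fun_const assms(2)] by simp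
qed

lemma smooth_fun_real_affine:
  fixes f :: "real \<Rightarrow> real"
  assumes "smooth_fun f"
  shows "smooth_fun (\<lambda>x. f (a * x + c))"
  using smooth_fun_affine_compose[OF assms, of "\<lambda>x. a * x" c] by (simp add: bounded_linear_mult_right)

text \<open>
  With \<open>p = 1\<close> this is the classical smooth function that is flat at \<open>0\<close>.  The polynomial factor makes
  the family closed under differentiation, which is what the coinduction for smoothness needs.
\<close>

definition flat_exp :: "real poly \<Rightarrow> real \<Rightarrow> real" where
  "flat_exp p x = (if x \<le> 0 then 0 else poly p (1 / x) * exp (- (1 / x)))"

lemma poly_times_exp_minus_tendsto_0:
  "((\<lambda>y. poly p y * exp (- y)) \<longlongrightarrow> (0::real)) at_top"
proof -
  have "((\<lambda>y. \<Sum>i\<le>degree p. coeff p i * (y ^ i / exp y)) \<longlongrightarrow> (\<Sum>i\<le>degree p. coeff p i * 0)) at_top"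
    by (intro tendsto_intros tendsto_power_div_exp_0)
  then show ?thesis
    by (simp add: poly_altdef sum_distrib_right exp_minus divide_inverse mult.assoc)
qed

lemma flat_exp_tendsto_0: "(flat_exp p \<longlongrightarrow> 0) (at_right 0)"
proof -
  have "((\<lambda>x. poly p (inverse x) * exp (- inverse x)) \<longlongrightarrow> (0::real)) (at_right 0)"
    by (rule filterlim_compose[OF poly_times_exp_minus_tendsto_0 filterlim_inverse_at_top_right])
  moreover have "\<forall>\<^sub>F x in at_right 0. poly p (inverse x) * exp (- inverse x) = flat_exp p x"
    unfolding eventually_at_right_field
    by (intro exI[of _ 1]) (auto simp: flat_exp_def divide_inverse)
  ultimately show ?thesis by (rule Lim_transform_eventually)
qed

text \<open>
  With \<open>y = 1 / x\<close> one has \<open>dy / dx = - y\<^sup>2\<close>, so \<open>p(y) exp(- y)\<close> becomes \<open>y\<^sup>2 (p - p')(y) exp(- y)\<close>.  The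
  difference quotient at \<open>0\<close>, taken from the right, is \<open>y p(y) exp(- y)\<close>, again a member of the family
  and therefore convergent to \<open>0\<close>.
\<close>

lemma flat_exp_has_derivative:
  "(flat_exp p has_real_derivative flat_exp ([:0, 0, 1:] * (p - pderiv p)) x) (at x)"
proof -
  consider "x < 0" | "x = 0" | "x > 0" by linarith
  then show ?thesis
  proof cases
    case 1
    have "((\<lambda>_. 0) has_real_derivative 0) (at x)" by simp
    then have "(flat_exp p has_real_derivative 0) (at x)"
      by (rule has_field_derivative_transform_within_open[where S="{..<0}"])
        (use 1 in \<open>auto simp: flat_exp_def\<close>)
    then show ?thesis using 1 by (simp add: flat_exp_def)
  next
    case 2
    have "((\<lambda>y. flat_exp p y / y) \<longlongrightarrow> 0) (at_left 0)"
      by (rule tendsto_eventually)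
        (auto simp: eventually_at_left_field flat_exp_def intro: exI[of _ "-1"])
    moreover have "((\<lambda>y. flat_exp p y / y) \<longlongrightarrow> 0) (at_right 0)"
    proof (rule Lim_transform_eventually[OF flat_exp_tendsto_0])
      show "\<forall>\<^sub>F y in at_right 0. flat_exp (pCons 0 p) y = flat_exp p y / y"
        unfolding eventually_at_right_field
        by (intro exI[of _ 1]) (auto simp: flat_exp_def)
    qed
    ultimately have "((\<lambda>y. flat_exp p y / y) \<longlongrightarrow> 0) (at 0)"
      by (simp add: filterlim_split_at)
    then show ?thesis using 2 by (simp add: has_field_derivative_iff flat_exp_def)
  next
    case 3
    have r: "((\<lambda>y. 1 / y) has_real_derivative - ((1 / x)\<^sup>2)) (at x)"
      using 3 DERIV_inverse[of x UNIV] by (simp add: divide_inverse power2_eq_square)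
    have "((\<lambda>y. poly p (1 / y) * exp (- (1 / y))) has_real_derivative
        poly ([:0, 0, 1:] * (p - pderiv p)) (1 / x) * exp (- (1 / x))) (at x)"
      by (rule DERIV_cong[OF DERIV_mult[OF DERIV_chain2[OF poly_DERIV r]
              DERIV_chain2[OF DERIV_exp DERIV_minus[OF r]]]])
        (simp add: power2_eq_square algebra_simps)
    then have "(flat_exp p has_real_derivative
        poly ([:0, 0, 1:] * (p - pderiv p)) (1 / x) * exp (- (1 / x))) (at x)"
      by (rule has_field_derivative_transform_within_open[where S="{0<..}"])
        (use 3 in \<open>auto simp: flat_exp_def\<close>)
    then show ?thesis using 3 by (simp add: flat_exp_def)
  qed
qed

lemma smooth_fun_flat_exp: "smooth_fun (flat_exp p)"
proof (coinduction arbitrary: p)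
  case smooth_fun
  have "frechet_derivative (flat_exp p) (at z) h =
      flat_exp (smult h ([:0, 0, 1:] * (p - pderiv p))) z" for z h
    unfolding frechet_derivative_real[OF flat_exp_has_derivative]
    by (simp add: flat_exp_def algebra_simps)
  moreover have "flat_exp p differentiable at z" for z
    using flat_exp_has_derivative real_differentiable_def by blast
  ultimately show ?case by blast
qed

text \<open>
  The factor \<open>exp 2\<close> normalises the bump to be at least \<open>1\<close> on \<open>[-1, 1]\<close>, where both flat factors are
  at least \<open>exp (-1)\<close>.
\<close>

definition bump :: "real \<Rightarrow> real" where
  "bump x = exp 2 * (flat_exp 1 (2 + x) * flat_exp 1 (2 - x))"

lemma smooth_fun_bump: "smooth_fun bump"
  using smooth_fun_mult[OF smooth_fun_const smooth_fun_mult[OF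
      smooth_fun_real_affine[OF smooth_fun_flat_exp[of 1], of 1 2]
      smooth_fun_real_affine[OF smooth_fun_flat_exp[of 1], of "-1" 2]], of "exp 2"]
  by (simp add: bump_def[abs_def] add.commute)

lemma bump_nonneg: "0 \<le> bump x"
  by (simp add: bump_def flat_exp_def)

lemma bump_le: "bump x \<le> exp 2"
proof -
  have "0 \<le> flat_exp 1 y" "flat_exp 1 y \<le> 1" for y
    by (simp_all add: flat_exp_def)
  then have "flat_exp 1 (2 + x) * flat_exp 1 (2 - x) \<le> 1 * 1" by (intro mult_mono) simp_all
  then show ?thesis by (simp add: bump_def)
qed

lemma bump_eq_0: "bump x = 0" if "x \<notin> {-2..2}"
  using that by (auto simp: bump_def flat_exp_def)

lemma bump_ge_1: "1 \<le> bump x" if "\<bar>x\<bar> \<le> 1"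
proof -
  have *: "exp (-1) \<le> flat_exp 1 y" if "1 \<le> y" for y
    using that by (simp add: flat_exp_def)
  have "exp (-1) * exp (-1::real) \<le> flat_exp 1 (2 + x) * flat_exp 1 (2 - x)"
    using that by (intro mult_mono *) (auto simp: flat_exp_def)
  then have "exp 2 * (exp (-1) * exp (-1::real)) \<le> bump x"
    unfolding bump_def by (rule mult_left_mono) simp
  then show ?thesis by (simp add: exp_add[symmetric])
qed

section \<open>Cutoffs and separated test functions\<close>

lemma deriv_eq_0_outside:
  fixes f :: "real \<Rightarrow> real"
  assumes "smooth_fun f" "\<And>x. x \<notin> {a..b} \<Longrightarrow> f x = 0" "x \<notin> {a..b}"
  shows "deriv f x = 0"
proof -
  have "((\<lambda>_. 0) has_real_derivative 0) (at x)" by simp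
  then have "(f has_real_derivative 0) (at x)"
    by (rule has_field_derivative_transform_within_open[where S="- {a..b}"])
      (use assms in auto)
  then show ?thesis by (rule DERIV_imp_deriv)
qed

lemma continuous_on_smooth_fun:
  fixes f :: "real \<Rightarrow> real"
  assumes "smooth_fun f"
  shows "continuous_on S f"
  using smooth_fun_has_derivative[OF assms] DERIV_isCont continuous_at_imp_continuous_on by blast

lemma borel_measurable_smooth_fun:
  fixes f :: "real \<Rightarrow> real"
  assumes "smooth_fun f"
  shows "f \<in> borel_measurable borel"
  using continuous_on_smooth_fun[OF assms] by (rule borel_measurable_continuous_onI)

lemma smooth_fun_compact_support_bounded:
  fixes f :: "real \<Rightarrow> real"
  assumes "smooth_fun f" "\<And>x. x \<notin> {a..b} \<Longrightarrow> f x = 0"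
  obtains K where "\<And>x. \<bar>f x\<bar> \<le> K"
proof -
  have "bounded (f ` {a..b})"
    by (intro compact_imp_bounded compact_continuous_image continuous_on_smooth_fun assms compact_Icc)
  then obtain K where K: "\<forall>x\<in>{a..b}. \<bar>f x\<bar> \<le> K"
    by (auto simp: bounded_iff)
  show ?thesis
  proof (rule that[of "max 0 K"])
    show "\<bar>f x\<bar> \<le> max 0 K" for x
      using K assms(2)[of x] by (cases "x \<in> {a..b}") (auto simp: le_max_iff_disj)
  qed
qed

lemma bump_primitive: "\<exists>B. \<forall>x. (B has_real_derivative bump x) (at x)"
proof (intro exI allI)
  fix x :: real
  show "((\<lambda>x. LBINT y=ereal 0..ereal x. bump y) has_real_derivative bump x) (at x)"
  proof -
    have "((\<lambda>x. LBINT y=ereal 0..ereal x. bump y) has_vector_derivative bump x)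
        (at x within {min (-1) (x - 1)..max 1 (x + 1)})"
      by (rule interval_integral_FTC2)
        (auto intro: continuous_on_smooth_fun smooth_fun_bump)
    moreover have "at x within {min (-1) (x - 1)..max 1 (x + 1)} = at x"
      by (rule at_within_interior) auto
    ultimately show ?thesis by (simp add: has_real_derivative_iff_has_vector_derivative)
  qed
qed

text \<open>
  This is the weight of the virial argument.  A compactly supported function cannot be increasing
  everywhere, but it can return to zero as slowly as one likes: with \<open>B\<close> a primitive of the bump,
  \<open>B(x) - B(\<kappa> x)\<close> rises near the origin at a rate close to that of \<open>B\<close> and
  falls elsewhere at a rate of order \<open>\<kappa>\<close>.  It has compact
  support because \<open>B\<close> is constant on either side of the support of the bump.
\<close>

lemma slowly_decreasing_cutoff:
  fixes \<epsilon> :: real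
  assumes "0 < \<epsilon>"
  shows "\<exists>W R. smooth_fun W \<and> (\<forall>x. x \<notin> {-R..R} \<longrightarrow> W x = 0) \<and>
    (\<forall>x. indicator {-1..1} x - \<epsilon> \<le> deriv W x)"
proof -
  obtain B where B: "\<And>x. (B has_real_derivative bump x) (at x)"
    using bump_primitive by blast
  define \<kappa> where "\<kappa> = min 1 (\<epsilon> / exp 2)"
  have \<kappa>: "0 < \<kappa>" "\<kappa> \<le> 1" "\<kappa> * exp 2 \<le> \<epsilon>"
    using assms by (auto simp: \<kappa>_def min_def field_simps)
  define W where "W x = B x + (-1) * B (\<kappa> * x + 0)" for x
  have B_smooth: "smooth_fun B" using smooth_fun_primitive[OF B smooth_fun_bump] .
  have W_smooth: "smooth_fun W"
    unfolding W_def
    by (rule smooth_fun_add[OF B_smooth smooth_fun_mult[OF smooth_fun_const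
          smooth_fun_real_affine[OF B_smooth]]])
  have W_deriv: "deriv W x = bump x - \<kappa> * bump (\<kappa> * x)" for x
  proof (rule DERIV_imp_deriv)
    show "(W has_real_derivative bump x - \<kappa> * bump (\<kappa> * x)) (at x)"
      unfolding W_def
      by (rule DERIV_cong[OF DERIV_add[OF B DERIV_cmult[OF DERIV_chain2[OF B
                DERIV_add[OF DERIV_cmult_Id DERIV_const]]]]]) simp
  qed
  have W_eq_0: "W x = 0" if "x \<notin> {-(2 / \<kappa>)..2 / \<kappa>}" for x
  proof -
    have "0 < 2 / \<kappa>" using \<kappa> by simp
    moreover have "x < - (2 / \<kappa>) \<or> 2 / \<kappa> < x"
      using that unfolding atLeastAtMost_iff by linarith
    ultimately have "x < 0 \<and> 2 / \<kappa> < - x \<or> 0 < x \<and> 2 / \<kappa> < x" by linarith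
    then have "x < 0 \<and> 2 < - x * \<kappa> \<or> 0 < x \<and> 2 < x * \<kappa>"
      using \<kappa>(1) by (simp only: pos_divide_less_eq)
    then show ?thesis
    proof
      assume x: "x < 0 \<and> 2 < - x * \<kappa>"
      \<comment> \<open>the mean value is taken at a point outside the support of the bump\<close>
      have "B (\<kappa> * x) = B x"
      proof (cases "\<kappa> = 1")
        case False
        then have "x < \<kappa> * x" using x \<kappa> by (simp add: mult_less_cancel_right2)
        then obtain z where z: "z < \<kappa> * x" "B (\<kappa> * x) - B x = (\<kappa> * x - x) * bump z"
          using MVT2[of x "\<kappa> * x" B bump] B by blast
        then have "bump z = 0" using x by (intro bump_eq_0) (auto simp: mult.commute)
        then show ?thesis using z by simp
      qed simp
      then show ?thesis by (simp add: W_def)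
    next
      assume x: "0 < x \<and> 2 < x * \<kappa>"
      have "B (\<kappa> * x) = B x"
      proof (cases "\<kappa> = 1")
        case False
        then have "\<kappa> * x < x" using x \<kappa> by simp
        then obtain z where z: "\<kappa> * x < z" "B x - B (\<kappa> * x) = (x - \<kappa> * x) * bump z"
          using MVT2[of "\<kappa> * x" x B bump] B by blast
        then have "bump z = 0" using x by (intro bump_eq_0) (auto simp: mult.commute)
        then show ?thesis using z by simp
      qed simp
      then show ?thesis by (simp add: W_def)
    qed
  qed
  have "indicator {-1..1} x - \<epsilon> \<le> deriv W x" for x
  proof -
    have "\<kappa> * bump (\<kappa> * x) \<le> \<epsilon>"
      using mult_left_mono[OF bump_le[of "\<kappa> * x"], of \<kappa>] \<kappa> by linarith
    moreover have "indicator {-1..1} x \<le> bump x"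
      using bump_ge_1[of x] bump_nonneg[of x] by (auto simp: indicator_def)
    ultimately show ?thesis by (simp add: W_deriv)
  qed
  with W_smooth W_eq_0 show ?thesis by blast
qed

lemma frechet_derivative_product:
  fixes f g :: "real \<Rightarrow> real"
  assumes "smooth_fun f" "smooth_fun g"
  shows "frechet_derivative (\<lambda>z. f (fst z) * g (snd z)) (at z) h =
    f (fst z) * (deriv g (snd z) * snd h) + (deriv f (fst z) * fst h) * g (snd z)"
proof -
  have "((\<lambda>z. f (fst z) * g (snd z)) has_derivative
      (\<lambda>h. f (fst z) * (deriv g (snd z) * snd h) + (deriv f (fst z) * fst h) * g (snd z))) (at z)"
    using smooth_fun_has_derivative[OF assms(1), of "fst z"]
      smooth_fun_has_derivative[OF assms(2), of "snd z"]
    unfolding has_field_derivative_def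
    by (intro has_derivative_mult has_derivative_compose[of fst fst _ _ f]
        has_derivative_compose[of snd snd _ _ g] has_derivative_fst has_derivative_snd
        has_derivative_ident)
  from fun_cong[OF frechet_derivative_at[OF this], of h] show ?thesis by (rule sym)
qed

lemma Dx_product:
  fixes f g :: "real \<Rightarrow> real"
  assumes "smooth_fun f" "smooth_fun g"
  shows "Dx (\<lambda>z. f (fst z) * g (snd z)) = (\<lambda>z. deriv f (fst z) * g (snd z))"
  unfolding Dx_def frechet_derivative_product[OF assms] by simp

lemma Dt_product:
  fixes f g :: "real \<Rightarrow> real"
  assumes "smooth_fun f" "smooth_fun g"
  shows "Dt (\<lambda>z. f (fst z) * g (snd z)) = (\<lambda>z. f (fst z) * deriv g (snd z))"
  unfolding Dt_def frechet_derivative_product[OF assms] by simp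

lemma test_fun_product:
  fixes f g :: "real \<Rightarrow> real"
  assumes "smooth_fun f" "smooth_fun g"
    and "\<And>x. x \<notin> {a..b} \<Longrightarrow> f x = 0" "\<And>t. t \<notin> {c..d} \<Longrightarrow> g t = 0" "0 < c"
  shows "test_fun (UNIV \<times> {0<..}) (\<lambda>z. f (fst z) * g (snd z))"
proof -
  have "smooth_fun (\<lambda>z::real \<times> real. f (fst z) * g (snd z))"
    using smooth_fun_mult[OF smooth_fun_affine_compose[OF assms(1) bounded_linear_fst, of 0]
        smooth_fun_affine_compose[OF assms(2) bounded_linear_snd, of 0]] by simp
  moreover have sub: "closure {z. f (fst z) * g (snd z) \<noteq> 0} \<subseteq> {a..b} \<times> {c..d}"
  proof (rule closure_minimal)
    show "{z. f (fst z) * g (snd z) \<noteq> 0} \<subseteq> {a..b} \<times> {c..d}"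
    proof
      fix z assume "z \<in> {z. f (fst z) * g (snd z) \<noteq> 0}"
      then have "fst z \<in> {a..b}" "snd z \<in> {c..d}"
        using assms(3)[of "fst z"] assms(4)[of "snd z"] by force+
      then show "z \<in> {a..b} \<times> {c..d}" by (simp add: mem_Times_iff)
    qed
  qed (intro closed_Times closed_atLeastAtMost)
  moreover have "compact (closure {z. f (fst z) * g (snd z) \<noteq> 0})"
    unfolding compact_eq_bounded_closed
    by (intro conjI closed_closure bounded_subset[OF _ sub] compact_imp_bounded compact_Times compact_Icc)
  moreover have "{a..b} \<times> {c..d} \<subseteq> UNIV \<times> {0<..}" using assms(5) by auto
  ultimately show ?thesis unfolding test_fun_def by blast
qed

section \<open>Square-integrable functions and continuity in time\<close>

definition L2_size :: "(real \<Rightarrow> 'b::euclidean_space) \<Rightarrow> real" where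
  "L2_size f = sqrt (LINT x|lborel. (norm (f x))\<^sup>2)"

lemma L2_size_nonneg: "0 \<le> L2_size f"
  by (simp add: L2_size_def)

lemma L2_size_power2: "(L2_size f)\<^sup>2 = (LINT x|lborel. (norm (f x))\<^sup>2)"
  by (simp add: L2_size_def integral_nonneg_AE)

lemma L2_size_le_H1_norm: "L2_size f \<le> H1_norm f"
  by (simp add: L2_size_def H1_norm_def integral_nonneg_AE)

lemma L2_measurable: "f \<in> L2 \<Longrightarrow> f \<in> borel_measurable lborel"
  by (simp add: L2_def)

lemma L2_integrable: "f \<in> L2 \<Longrightarrow> integrable lborel (\<lambda>x. (norm (f x))\<^sup>2)"
  by (simp add: L2_def)

lemma L2_mult_integrable:
  assumes "f \<in> L2" "g \<in> L2"
  shows "integrable lborel (\<lambda>x. norm (f x) * norm (g x))"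
proof (rule Bochner_Integration.integrable_bound)
  show "integrable lborel (\<lambda>x. (norm (f x))\<^sup>2 + (norm (g x))\<^sup>2)"
    using assms by (intro Bochner_Integration.integrable_add L2_integrable)
  show "(\<lambda>x. norm (f x) * norm (g x)) \<in> borel_measurable lborel"
    using assms[THEN L2_measurable] by measurable
  have "a * b \<le> a\<^sup>2 + b\<^sup>2" if "0 \<le> a" "0 \<le> b" for a b :: real
    using sum_squares_bound[of a b] mult_nonneg_nonneg[OF that] by simp
  then show "AE x in lborel. norm (norm (f x) * norm (g x)) \<le> norm ((norm (f x))\<^sup>2 + (norm (g x))\<^sup>2)"
    by simp
qed

lemma Cauchy_Schwarz_L2:
  assumes "f \<in> L2" "g \<in> L2"
  shows "(LINT x|lborel. norm (f x) * norm (g x)) \<le> L2_size f * L2_size g"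
proof -
  define A B C where "A = (LINT x|lborel. (norm (f x))\<^sup>2)"
    and "B = (LINT x|lborel. (norm (g x))\<^sup>2)"
    and "C = (LINT x|lborel. norm (f x) * norm (g x))"
  have quad: "0 \<le> A - 2 * s * C + s\<^sup>2 * B" for s
  proof -
    have "0 \<le> (LINT x|lborel. (norm (f x) - s * norm (g x))\<^sup>2)"
      by (rule integral_nonneg_AE) simp
    also have "\<dots> = (LINT x|lborel. (norm (f x))\<^sup>2 - 2 * s * (norm (f x) * norm (g x)) + s\<^sup>2 * (norm (g x))\<^sup>2)"
      by (simp add: power2_diff power_mult_distrib algebra_simps)
    also have "\<dots> = A - 2 * s * C + s\<^sup>2 * B"
      using L2_integrable[OF assms(1)] L2_integrable[OF assms(2)] L2_mult_integrable[OF assms]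
      by (simp add: A_def B_def C_def)
    finally show ?thesis .
  qed
  have nonneg: "0 \<le> A" "0 \<le> B" "0 \<le> C"
    by (simp_all add: A_def B_def C_def integral_nonneg_AE)
  have "C\<^sup>2 \<le> A * B"
  proof (cases "B = 0")
    case True
    have "C = 0"
    proof (rule ccontr)
      assume "C \<noteq> 0"
      then have "0 \<le> A - (A + 1)"
        using quad[of "(A + 1) / (2 * C)"] True by simp
      then show False by simp
    qed
    then show ?thesis using True by simp
  next
    case False
    then have "0 < B" using nonneg by simp
    have "0 \<le> A - C\<^sup>2 / B"
      using quad[of "C / B"] False by (simp add: power2_eq_square field_simps)
    then show ?thesis using \<open>0 < B\<close> by (simp add: field_simps)
  qed
  then have "C \<le> sqrt (A * B)" by (rule real_le_rsqrt)
  then show ?thesis by (simp add: A_def B_def C_def L2_size_def real_sqrt_mult)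
qed

lemma L2_diff:
  assumes "f \<in> L2" "g \<in> L2"
  shows "(\<lambda>x. f x - g x) \<in> L2"
proof -
  have "integrable lborel (\<lambda>x. (norm (f x - g x))\<^sup>2)"
  proof (rule Bochner_Integration.integrable_bound)
    show "integrable lborel (\<lambda>x. 2 * (norm (f x))\<^sup>2 + 2 * (norm (g x))\<^sup>2)"
      using assms by (intro Bochner_Integration.integrable_add integrable_mult_right L2_integrable)
    show "(\<lambda>x. (norm (f x - g x))\<^sup>2) \<in> borel_measurable lborel"
      using assms[THEN L2_measurable] by measurable
    have "(norm (a - b))\<^sup>2 \<le> 2 * (norm a)\<^sup>2 + 2 * (norm b)\<^sup>2" for a b :: 'a
    proof -
      have "(norm (a - b))\<^sup>2 \<le> (norm a + norm b)\<^sup>2"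
        by (intro power_mono norm_triangle_ineq4) simp
      also have "\<dots> \<le> 2 * (norm a)\<^sup>2 + 2 * (norm b)\<^sup>2"
        using sum_squares_bound[of "norm a" "norm b"] by (simp add: power2_sum)
      finally show ?thesis .
    qed
    then show "AE x in lborel. norm ((norm (f x - g x))\<^sup>2)
        \<le> norm (2 * (norm (f x))\<^sup>2 + 2 * (norm (g x))\<^sup>2)"
      by simp
  qed
  then show ?thesis
    using assms[THEN L2_measurable] by (simp add: L2_def)
qed

lemma L2_pairing_integrable:
  fixes f g :: "real \<Rightarrow> real"
  assumes "f \<in> L2" "g \<in> L2"
  shows "integrable lborel (\<lambda>x. f x * g x)"
proof (rule Bochner_Integration.integrable_bound[OF L2_mult_integrable[OF assms]])
  show "(\<lambda>x. f x * g x) \<in> borel_measurable lborel"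
    using assms[THEN L2_measurable] by measurable
qed (simp add: abs_mult)

lemma L2_pairing_bound:
  fixes f g :: "real \<Rightarrow> real"
  assumes "f \<in> L2" "g \<in> L2"
  shows "\<bar>LINT x|lborel. f x * g x\<bar> \<le> L2_size f * L2_size g"
proof -
  have "\<bar>LINT x|lborel. f x * g x\<bar> \<le> (LINT x|lborel. \<bar>f x * g x\<bar>)"
    by (rule integral_abs_bound)
  also have "\<dots> \<le> L2_size f * L2_size g"
    using Cauchy_Schwarz_L2[OF assms] by (simp add: abs_mult)
  finally show ?thesis .
qed

lemma bounded_weight_integrable:
  fixes w :: "real \<Rightarrow> real"
  assumes "f \<in> L2" "w \<in> borel_measurable lborel" "\<And>x. \<bar>w x\<bar> \<le> K"
  shows "integrable lborel (\<lambda>x. w x * (norm (f x))\<^sup>2)"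
proof (rule Bochner_Integration.integrable_bound)
  show "integrable lborel (\<lambda>x. K * (norm (f x))\<^sup>2)"
    using L2_integrable[OF assms(1)] by simp
  show "(\<lambda>x. w x * (norm (f x))\<^sup>2) \<in> borel_measurable lborel"
    using assms(2) L2_measurable[OF assms(1)] by measurable
  have "0 \<le> K" using assms(3)[of 0] by linarith
  then show "AE x in lborel. norm (w x * (norm (f x))\<^sup>2) \<le> norm (K * (norm (f x))\<^sup>2)"
    using assms(3) by (simp add: abs_mult mult_right_mono)
qed

lemma continuous_into_H1_L2:
  assumes "continuous_into_H1 {0..} w" "0 \<le> t"
  shows "w t \<in> L2"
  using assms by (auto simp: continuous_into_H1_def H1_def)

lemma continuous_into_H1_L2_size:
  assumes "continuous_into_H1 {0..} w" "0 \<le> s"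
  shows "((\<lambda>t. L2_size (\<lambda>x. w t x - w s x)) \<longlongrightarrow> 0) (at s within {0..})"
proof (rule Lim_null_comparison)
  show "((\<lambda>t. H1_norm (\<lambda>x. w t x - w s x)) \<longlongrightarrow> 0) (at s within {0..})"
    using assms by (simp add: continuous_into_H1_def)
qed (simp add: L2_size_nonneg L2_size_le_H1_norm)

lemma eventually_within_nonneg: "\<forall>\<^sub>F t in at (s::real) within {0..}. 0 \<le> t"
  by (simp add: eventually_at_filter)

text \<open>
  This continuity and that of the weighted squares below are what makes the time integrals in the
  distributional equation converge, so that they can be split into separate terms.
\<close>

lemma continuous_on_L2_pairing:
  fixes w :: "real \<Rightarrow> real \<Rightarrow> real"
  assumes w: "continuous_into_H1 {0..} w" and f: "f \<in> L2"
  shows "continuous_on {0..} (\<lambda>t. LINT x|lborel. f x * w t x)"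
  unfolding continuous_on_def
proof
  fix s :: real assume s: "s \<in> {0..}"
  have "((\<lambda>t. (LINT x|lborel. f x * w t x) - (LINT x|lborel. f x * w s x)) \<longlongrightarrow> 0) (at s within {0..})"
  proof (rule Lim_null_comparison)
    show "((\<lambda>t. L2_size f * L2_size (\<lambda>x. w t x - w s x)) \<longlongrightarrow> 0) (at s within {0..})"
      using tendsto_mult[OF tendsto_const[of "L2_size f"] continuous_into_H1_L2_size[OF w, of s]] s
      by simp
    show "\<forall>\<^sub>F t in at s within {0..}. norm ((LINT x|lborel. f x * w t x) - (LINT x|lborel. f x * w s x))
        \<le> L2_size f * L2_size (\<lambda>x. w t x - w s x)"
      using eventually_within_nonneg
    proof eventually_elim
      case (elim t)
      have L2: "w t \<in> L2" "w s \<in> L2"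
        using elim s continuous_into_H1_L2[OF w] by auto
      have "(LINT x|lborel. f x * w t x) - (LINT x|lborel. f x * w s x) =
          (LINT x|lborel. f x * (w t x - w s x))"
        using L2[THEN L2_pairing_integrable[OF f]] by (simp add: right_diff_distrib)
      then show ?case
        using L2_pairing_bound[OF f L2_diff[OF L2]] by simp
    qed
  qed
  then show "((\<lambda>t. LINT x|lborel. f x * w t x) \<longlongrightarrow> (LINT x|lborel. f x * w s x)) (at s within {0..})"
    by (rule Lim_null[THEN iffD2])
qed

lemma abs_square_diff_le:
  fixes a b c :: real
  assumes "0 \<le> a" "0 \<le> b" "\<bar>a - b\<bar> \<le> c"
  shows "\<bar>a\<^sup>2 - b\<^sup>2\<bar> \<le> c\<^sup>2 + 2 * (c * b)"
proof -
  have "\<bar>a\<^sup>2 - b\<^sup>2\<bar> = \<bar>a - b\<bar> * \<bar>a + b\<bar>"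
    by (simp only: abs_mult[symmetric]) (simp add: power2_eq_square algebra_simps)
  also have "\<dots> \<le> c * (c + 2 * b)"
    using assms by (intro mult_mono) auto
  also have "\<dots> = c\<^sup>2 + 2 * (c * b)"
    by (simp add: power2_eq_square algebra_simps)
  finally show ?thesis .
qed

lemma continuous_on_weighted_square:
  fixes f :: "real \<Rightarrow> real"
  assumes w: "continuous_into_H1 {0..} w"
    and f: "f \<in> borel_measurable lborel" "\<And>x. \<bar>f x\<bar> \<le> K"
  shows "continuous_on {0..} (\<lambda>t. LINT x|lborel. f x * (norm (w t x))\<^sup>2)"
  unfolding continuous_on_def
proof
  fix s :: real assume s: "s \<in> {0..}"
  define d where "d t = L2_size (\<lambda>x. w t x - w s x)" for t
  have "((\<lambda>t. (LINT x|lborel. f x * (norm (w t x))\<^sup>2) - (LINT x|lborel. f x * (norm (w s x))\<^sup>2)) \<longlongrightarrow> 0)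
      (at s within {0..})"
  proof (rule Lim_null_comparison)
    have "(d \<longlongrightarrow> 0) (at s within {0..})"
      using continuous_into_H1_L2_size[OF w, of s] s by (simp add: d_def[abs_def])
    then have "((\<lambda>t. K * ((d t)\<^sup>2 + 2 * (d t * L2_size (w s)))) \<longlongrightarrow>
        K * (0\<^sup>2 + 2 * (0 * L2_size (w s)))) (at s within {0..})"
      by (intro tendsto_intros)
    then show "((\<lambda>t. K * ((d t)\<^sup>2 + 2 * (d t * L2_size (w s)))) \<longlongrightarrow> 0) (at s within {0..})"
      by simp
    show "\<forall>\<^sub>F t in at s within {0..}.
        norm ((LINT x|lborel. f x * (norm (w t x))\<^sup>2) - (LINT x|lborel. f x * (norm (w s x))\<^sup>2))
        \<le> K * ((d t)\<^sup>2 + 2 * (d t * L2_size (w s)))"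
      using eventually_within_nonneg
    proof eventually_elim
      case (elim t)
      have L2: "w t \<in> L2" "w s \<in> L2"
        using elim s continuous_into_H1_L2[OF w] by auto
      note diff = L2_diff[OF L2]
      have K: "0 \<le> K" using f(2)[of 0] by linarith
      have "(LINT x|lborel. f x * (norm (w t x))\<^sup>2) - (LINT x|lborel. f x * (norm (w s x))\<^sup>2) =
          (LINT x|lborel. f x * (norm (w t x))\<^sup>2 - f x * (norm (w s x))\<^sup>2)"
        using L2[THEN bounded_weight_integrable[OF _ f]] by simp
      then have "norm ((LINT x|lborel. f x * (norm (w t x))\<^sup>2) - (LINT x|lborel. f x * (norm (w s x))\<^sup>2))
          = \<bar>LINT x|lborel. f x * (norm (w t x))\<^sup>2 - f x * (norm (w s x))\<^sup>2\<bar>" by simp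
      also have "\<dots> \<le> (LINT x|lborel. \<bar>f x * (norm (w t x))\<^sup>2 - f x * (norm (w s x))\<^sup>2\<bar>)"
        by (rule integral_abs_bound)
      also have "\<dots> \<le> (LINT x|lborel. K * ((norm (w t x - w s x))\<^sup>2 +
          2 * (norm (w t x - w s x) * norm (w s x))))"
      proof (rule integral_mono)
        show "integrable lborel (\<lambda>x. \<bar>f x * (norm (w t x))\<^sup>2 - f x * (norm (w s x))\<^sup>2\<bar>)"
          using L2[THEN bounded_weight_integrable[OF _ f]]
          by (intro integrable_abs Bochner_Integration.integrable_diff)
        show "integrable lborel (\<lambda>x. K * ((norm (w t x - w s x))\<^sup>2 +
            2 * (norm (w t x - w s x) * norm (w s x))))"
          using L2_integrable[OF diff] L2_mult_integrable[OF diff L2(2)]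
          by (intro integrable_mult_right Bochner_Integration.integrable_add)
        fix x :: real
        let ?a = "norm (w t x)" and ?b = "norm (w s x)" and ?c = "norm (w t x - w s x)"
        have c: "\<bar>?a - ?b\<bar> \<le> ?c" by (rule norm_triangle_ineq3)
        then have "\<bar>?a\<^sup>2 - ?b\<^sup>2\<bar> \<le> ?c\<^sup>2 + 2 * (?c * ?b)"
          by (intro abs_square_diff_le) auto
        with K f(2)[of x] have "\<bar>f x\<bar> * \<bar>?a\<^sup>2 - ?b\<^sup>2\<bar> \<le> K * (?c\<^sup>2 + 2 * (?c * ?b))"
          by (intro mult_mono) auto
        then show "\<bar>f x * ?a\<^sup>2 - f x * ?b\<^sup>2\<bar> \<le> K * (?c\<^sup>2 + 2 * (?c * ?b))"
          by (simp only: right_diff_distrib[symmetric] abs_mult)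
      qed
      also have "\<dots> = K * ((LINT x|lborel. (norm (w t x - w s x))\<^sup>2) +
          2 * (LINT x|lborel. norm (w t x - w s x) * norm (w s x)))"
        using L2_integrable[OF diff] L2_mult_integrable[OF diff L2(2)] by simp
      also have "\<dots> \<le> K * ((d t)\<^sup>2 + 2 * (d t * L2_size (w s)))"
        using K Cauchy_Schwarz_L2[OF diff L2(2)]
        by (intro mult_left_mono add_mono) (auto simp: d_def L2_size_power2)
      finally show ?case .
    qed
  qed
  then show "((\<lambda>t. LINT x|lborel. f x * (norm (w t x))\<^sup>2) \<longlongrightarrow>
      (LINT x|lborel. f x * (norm (w s x))\<^sup>2)) (at s within {0..})"
    by (rule Lim_null[THEN iffD2])
qed

lemma compact_support_times_continuous_integrable:
  fixes g h :: "real \<Rightarrow> real"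
  assumes "continuous_on UNIV g" "\<And>t. t \<notin> {a..b} \<Longrightarrow> g t = 0" "0 \<le> a" "continuous_on {0..} h"
  shows "integrable lborel (\<lambda>t. g t * h t)"
proof -
  have "continuous_on {a..b} (\<lambda>t. g t * h t)"
    using assms by (intro continuous_intros) (auto intro: continuous_on_subset)
  then have "set_integrable lborel {a..b} (\<lambda>t. g t * h t)"
    by (rule borel_integrable_atLeastAtMost')
  moreover have "(\<lambda>t. indicator {a..b} t *\<^sub>R (g t * h t)) = (\<lambda>t. g t * h t)"
    using assms(2) by (auto simp: fun_eq_iff indicator_def)
  ultimately show ?thesis by (simp only: set_integrable_def)
qed

lemma compact_support_L2:
  fixes f :: "real \<Rightarrow> real"
  assumes "smooth_fun f" "\<And>x. x \<notin> {a..b} \<Longrightarrow> f x = 0"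
  shows "f \<in> L2"
proof -
  have "continuous_on {a..b} (\<lambda>x. (f x)\<^sup>2)"
    by (intro continuous_intros continuous_on_smooth_fun assms)
  then have "set_integrable lborel {a..b} (\<lambda>x. (f x)\<^sup>2)"
    by (rule borel_integrable_atLeastAtMost')
  moreover have "(\<lambda>x. indicator {a..b} x *\<^sub>R (f x)\<^sup>2) = (\<lambda>x. (f x)\<^sup>2)"
    using assms(2) by (auto simp: fun_eq_iff indicator_def)
  ultimately have "integrable lborel (\<lambda>x. (f x)\<^sup>2)"
    by (simp only: set_integrable_def)
  then show ?thesis
    using borel_measurable_smooth_fun[OF assms(1)] by (simp add: L2_def)
qed

section \<open>The virial identity\<close>

text \<open>
  The KdV equation is the conservation law
  \<open>\<partial>\<^sub>t v + \<partial>\<^sub>x (\<partial>\<^sub>x\<^sup>2 v + flux) = 0\<close> with this nonlinear flux, where \<open>f\<close> stands for \<open>u(t)\<close> and \<open>g\<close> for \<open>v(t)\<close>.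
  For \<open>\<gamma> < 0\<close> it controls both \<open>v\<^sup>2\<close> and \<open>\<bar>u\<bar>\<^sup>2\<close>.
\<close>

definition flux :: "real \<Rightarrow> (real \<Rightarrow> complex) \<Rightarrow> (real \<Rightarrow> real) \<Rightarrow> real \<Rightarrow> real" where
  "flux \<gamma> f g x = (g x)\<^sup>2 / 2 - \<gamma> * (cmod (f x))\<^sup>2"

lemma flux_nonneg:
  assumes "\<gamma> \<le> 0"
  shows "0 \<le> flux \<gamma> f g x"
  using mult_nonpos_nonneg[OF assms zero_le_power2[of "cmod (f x)"]]
    zero_le_power2[of "g x"] unfolding flux_def by linarith

lemma flux_weight_integral:
  fixes w :: "real \<Rightarrow> real"
  assumes "f \<in> L2" "g \<in> L2" "w \<in> borel_measurable lborel" "\<And>x. \<bar>w x\<bar> \<le> K"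
  shows "integrable lborel (\<lambda>x. w x * flux \<gamma> f g x)"
    and "(LINT x|lborel. w x * flux \<gamma> f g x) =
      (LINT x|lborel. w x * (norm (g x))\<^sup>2) / 2 - \<gamma> * (LINT x|lborel. w x * (norm (f x))\<^sup>2)"
proof -
  have eq: "(\<lambda>x. w x * flux \<gamma> f g x) =
      (\<lambda>x. (w x * (norm (g x))\<^sup>2) / 2 - \<gamma> * (w x * (norm (f x))\<^sup>2))"
    by (auto simp: flux_def algebra_simps)
  note int = bounded_weight_integrable[OF assms(1,3,4)] bounded_weight_integrable[OF assms(2-4)]
  show "integrable lborel (\<lambda>x. w x * flux \<gamma> f g x)"
    unfolding eq using int
    by (intro Bochner_Integration.integrable_diff integrable_divide integrable_mult_right)
  show "(LINT x|lborel. w x * flux \<gamma> f g x) =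
      (LINT x|lborel. w x * (norm (g x))\<^sup>2) / 2 - \<gamma> * (LINT x|lborel. w x * (norm (f x))\<^sup>2)"
    unfolding eq using int
    by (subst Bochner_Integration.integral_diff) auto
qed

lemma flux_integrable:
  assumes "f \<in> L2" "g \<in> L2"
  shows "integrable lborel (flux \<gamma> f g)"
  using flux_weight_integral(1)[OF assms, of "\<lambda>_. 1" 1] by simp

lemma flux_integral_le:
  assumes "f \<in> L2" "g \<in> L2" "\<gamma> \<le> 0" "H1_norm f + H1_norm g \<le> M"
  shows "(LINT x|lborel. flux \<gamma> f g x) \<le> (1 / 2 - \<gamma>) * M\<^sup>2"
proof -
  have le: "(L2_size f)\<^sup>2 \<le> M\<^sup>2" "(L2_size g)\<^sup>2 \<le> M\<^sup>2"
    using assms(4) L2_size_le_H1_norm[of f] L2_size_le_H1_norm[of g]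
      L2_size_nonneg[of f] L2_size_nonneg[of g]
    by (auto intro!: power_mono)
  have "(LINT x|lborel. flux \<gamma> f g x) = (L2_size g)\<^sup>2 / 2 - \<gamma> * (L2_size f)\<^sup>2"
    using flux_weight_integral(2)[OF assms(1,2), of "\<lambda>_. 1" 1] by (simp add: L2_size_power2)
  also have "\<dots> \<le> M\<^sup>2 / 2 - \<gamma> * M\<^sup>2"
    using le assms(3) by (intro diff_mono divide_right_mono mult_left_mono_neg) auto
  finally show ?thesis by (simp add: algebra_simps)
qed

text \<open>
  The equation tested with \<open>f(x) g(t)\<close>: smoothed in time, this is the evolution of \<open>\<integral> f v dx\<close>.
\<close>

lemma virial_identity:
  assumes u: "continuous_into_H1 {0..} u" and v: "continuous_into_H1 {0..} v"
    and kdv: "kdv_eq \<gamma> u v"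
    and f: "smooth_fun f" "\<And>x. x \<notin> {r..s} \<Longrightarrow> f x = 0"
    and g: "smooth_fun g" "\<And>t. t \<notin> {a..b} \<Longrightarrow> g t = 0" "0 < a"
  shows "(LINT t|lborel. g t * (LINT x|lborel. deriv f x * flux \<gamma> (u t) (v t) x)) =
    - (LINT t|lborel. deriv g t * (LINT x|lborel. f x * v t x))
    - (LINT t|lborel. g t * (LINT x|lborel. deriv (deriv (deriv f)) x * v t x))"
proof -
  let ?f1 = "deriv f" and ?f2 = "deriv (deriv f)" and ?f3 = "deriv (deriv (deriv f))"
  note f1 = smooth_fun_deriv[OF f(1)] and f2 = smooth_fun_deriv[OF smooth_fun_deriv[OF f(1)]]
  note f3 = smooth_fun_deriv[OF f2]
  have f1_0: "x \<notin> {r..s} \<Longrightarrow> ?f1 x = 0" for x by (rule deriv_eq_0_outside[OF f])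
  have f2_0: "x \<notin> {r..s} \<Longrightarrow> ?f2 x = 0" for x by (rule deriv_eq_0_outside[OF f1 f1_0])
  have f3_0: "x \<notin> {r..s} \<Longrightarrow> ?f3 x = 0" for x by (rule deriv_eq_0_outside[OF f2 f2_0])
  have g1_0: "t \<notin> {a..b} \<Longrightarrow> deriv g t = 0" for t by (rule deriv_eq_0_outside[OF g(1,2)])
  have fL2: "f \<in> L2" and f3L2: "?f3 \<in> L2"
    using compact_support_L2[OF f] compact_support_L2[OF f3 f3_0] by auto
  obtain K where K: "\<And>x. \<bar>?f1 x\<bar> \<le> K"
    using smooth_fun_compact_support_bounded[OF f1 f1_0] by blast
  have f1_meas: "?f1 \<in> borel_measurable lborel"
    using borel_measurable_smooth_fun[OF f1] by simp
  define A B E P where "A t = (LINT x|lborel. f x * v t x)"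
    and "B t = (LINT x|lborel. ?f3 x * v t x)"
    and "E t = (LINT x|lborel. ?f1 x * (norm (v t x))\<^sup>2)"
    and "P t = (LINT x|lborel. ?f1 x * (norm (u t x))\<^sup>2)" for t
  have cont: "continuous_on {0..} A" "continuous_on {0..} B" "continuous_on {0..} E" "continuous_on {0..} P"
    unfolding A_def B_def E_def P_def
    using continuous_on_L2_pairing[OF v fL2] continuous_on_L2_pairing[OF v f3L2]
      continuous_on_weighted_square[OF v f1_meas K] continuous_on_weighted_square[OF u f1_meas K]
    by auto
  have int: "integrable lborel (\<lambda>t. g t * h t)" "integrable lborel (\<lambda>t. deriv g t * h t)"
    if "continuous_on {0..} h" for h
    using that g(3)
      compact_support_times_continuous_integrable[OF continuous_on_smooth_fun[OF g(1)] g(2)]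
      compact_support_times_continuous_integrable[OF continuous_on_smooth_fun[OF smooth_fun_deriv[OF g(1)]] g1_0]
    by auto
  let ?\<Phi> = "\<lambda>z. f (fst z) * g (snd z)"
  have tf: "test_fun (UNIV \<times> {0<..}) ?\<Phi>"
    by (rule test_fun_product[OF f(1) g(1) f(2) g(2,3)])
  have D: "Dx ?\<Phi> = (\<lambda>z. ?f1 (fst z) * g (snd z))"
    "Dx (\<lambda>z. ?f1 (fst z) * g (snd z)) = (\<lambda>z. ?f2 (fst z) * g (snd z))"
    "Dx (\<lambda>z. ?f2 (fst z) * g (snd z)) = (\<lambda>z. ?f3 (fst z) * g (snd z))"
    "Dt ?\<Phi> = (\<lambda>z. f (fst z) * deriv g (snd z))"
    using f(1) f1 f2 g(1) by (simp_all only: Dx_product Dt_product)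
  \<comment> \<open>outside the time support both sides vanish, whatever \<open>v t\<close> is for negative \<open>t\<close>\<close>
  have inner: "(LINT x|lborel. - (Dt ?\<Phi> (x, t) * v t x) - Dx (Dx (Dx ?\<Phi>)) (x, t) * v t x
        - Dx ?\<Phi> (x, t) * ((v t x)\<^sup>2 / 2)) = - (deriv g t * A t) - g t * B t - g t * E t / 2"
    (is "?I t = _") for t
  proof (cases "t \<in> {a..b}")
    case True
    with g(3) have vt: "v t \<in> L2" by (intro continuous_into_H1_L2[OF v]) auto
    have "?I t = (LINT x|lborel. - (deriv g t * (f x * v t x)) - g t * (?f3 x * v t x)
        - g t * (?f1 x * (norm (v t x))\<^sup>2) / 2)"
      by (simp only: D fst_conv snd_conv) (simp add: mult_ac)
    also have "\<dots> = - (deriv g t * A t) - g t * B t - g t * E t / 2"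
      using L2_pairing_integrable[OF fL2 vt] L2_pairing_integrable[OF f3L2 vt]
        bounded_weight_integrable[OF vt f1_meas K]
      by (simp add: A_def B_def E_def)
    finally show ?thesis .
  next
    case False
    then have "g t = 0" "deriv g t = 0" using g(2) g1_0 by blast+
    then show ?thesis by (simp add: D)
  qed
  have source: "(LINT x|lborel. - (Dx ?\<Phi> (x, t) * (\<gamma> * (cmod (u t x))\<^sup>2))) = - (\<gamma> * (g t * P t))"
    for t
  proof -
    have "(LINT x|lborel. - (Dx ?\<Phi> (x, t) * (\<gamma> * (cmod (u t x))\<^sup>2))) =
        (LINT x|lborel. - (\<gamma> * g t) * (?f1 x * (norm (u t x))\<^sup>2))"
      by (simp only: D fst_conv snd_conv) (simp add: mult_ac)
    also have "\<dots> = - (\<gamma> * g t) * P t"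
      unfolding P_def by (rule integral_mult_right_zero)
    finally show ?thesis by simp
  qed
  have "(LINT t|lborel. - (deriv g t * A t) - g t * B t - g t * E t / 2) =
      (LINT t|lborel. - (\<gamma> * (g t * P t)))"
    using kdv[unfolded kdv_eq_def, rule_format, OF tf] by (simp only: inner source)
  then have *: "- (LINT t|lborel. deriv g t * A t) - (LINT t|lborel. g t * B t)
      - (LINT t|lborel. g t * E t) / 2 = - (\<gamma> * (LINT t|lborel. g t * P t))"
    using int[OF cont(1)] int[OF cont(2)] int[OF cont(3)] int[OF cont(4)] by simp
  have "g t * (LINT x|lborel. ?f1 x * flux \<gamma> (u t) (v t) x) = g t * E t / 2 - \<gamma> * (g t * P t)" for t
  proof (cases "t \<in> {a..b}")
    case True
    with g(3) have "v t \<in> L2" "u t \<in> L2"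
      by (auto intro: continuous_into_H1_L2[OF v] continuous_into_H1_L2[OF u])
    then show ?thesis
      by (simp add: flux_weight_integral(2)[OF _ _ f1_meas K] E_def P_def algebra_simps)
  qed (simp add: g(2))
  then have "(LINT t|lborel. g t * (LINT x|lborel. ?f1 x * flux \<gamma> (u t) (v t) x)) =
      (LINT t|lborel. g t * E t) / 2 - \<gamma> * (LINT t|lborel. g t * P t)"
    using int[OF cont(3)] int[OF cont(4)] by simp
  with * show ?thesis by (simp add: A_def B_def)
qed

lemma deriv_rescale:
  fixes f :: "real \<Rightarrow> real"
  assumes "smooth_fun f"
  shows "deriv (\<lambda>x. k * f (c * x)) = (\<lambda>x. (k * c) * deriv f (c * x))"
proof
  fix x
  show "deriv (\<lambda>x. k * f (c * x)) x = (k * c) * deriv f (c * x)"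
    by (rule DERIV_imp_deriv, rule DERIV_cong[OF DERIV_cmult[OF DERIV_chain2[OF
            smooth_fun_has_derivative[OF assms] DERIV_cmult_Id]]]) simp
qed

lemma smooth_fun_rescale:
  fixes f :: "real \<Rightarrow> real"
  assumes "smooth_fun f"
  shows "smooth_fun (\<lambda>x. k * f (c * x))"
  using smooth_fun_mult[OF smooth_fun_const smooth_fun_real_affine[OF assms, of c 0]] by simp

lemma integral_rescale:
  fixes f :: "real \<Rightarrow> real"
  assumes "0 < c"
  shows "(LINT x|lborel. f (c * x)) = (LINT x|lborel. f x) / c"
  using lborel_integral_real_affine[of c f 0] assms by simp

lemma L2_size_rescale:
  fixes f :: "real \<Rightarrow> real"
  assumes "0 < c"
  shows "L2_size (\<lambda>x. k * f (c * x)) = \<bar>k\<bar> * L2_size f / sqrt c"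
  using integral_rescale[OF assms, of "\<lambda>x. (f x)\<^sup>2"]
  by (simp add: L2_size_def power_mult_distrib real_sqrt_mult real_sqrt_divide)

lemma support_rescale:
  fixes f :: "real \<Rightarrow> real"
  assumes "\<And>x. x \<notin> {a..b} \<Longrightarrow> f x = 0" "0 < l" "x \<notin> {l * a..l * b}"
  shows "k * f (1 / l * x) = 0"
proof -
  have "1 / l * x \<notin> {a..b}"
    using assms(2,3) by (auto simp: field_simps)
  then show ?thesis using assms(1) by simp
qed

lemma weighted_time_integral_bound:
  fixes g h :: "real \<Rightarrow> real"
  assumes g: "smooth_fun g" "\<And>t. t \<notin> {a..b} \<Longrightarrow> g t = 0" "0 \<le> a"
    and h: "continuous_on {0..} h" "\<And>t. 0 \<le> t \<Longrightarrow> \<bar>h t\<bar> \<le> c"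
  shows "\<bar>LINT t|lborel. g t * h t\<bar> \<le> c * (LINT t|lborel. \<bar>g t\<bar>)"
proof -
  have int: "integrable lborel (\<lambda>t. g t * h t)" if "continuous_on {0..} h" for h
    by (rule compact_support_times_continuous_integrable[OF continuous_on_smooth_fun[OF g(1)] g(2,3) that])
  have "\<bar>LINT t|lborel. g t * h t\<bar> \<le> (LINT t|lborel. \<bar>g t * h t\<bar>)"
    by (rule integral_abs_bound)
  also have "\<dots> \<le> (LINT t|lborel. c * \<bar>g t\<bar>)"
  proof (rule integral_mono)
    show "integrable lborel (\<lambda>t. \<bar>g t * h t\<bar>)" by (intro integrable_abs int h)
    show "integrable lborel (\<lambda>t. c * \<bar>g t\<bar>)"
      using integrable_abs[OF int[of "\<lambda>_. 1"]] by simp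
    show "\<bar>g t * h t\<bar> \<le> c * \<bar>g t\<bar>" for t
      using g(2)[of t] g(3) h(2)[of t]
      by (cases "t \<in> {a..b}") (auto simp: abs_mult mult.commute[of _ "\<bar>g t\<bar>"] intro: mult_left_mono)
  qed
  finally show ?thesis by simp
qed

lemma weighted_time_integral_lower_bound:
  fixes g h :: "real \<Rightarrow> real"
  assumes g: "smooth_fun g" "\<And>t. t \<notin> {a..b} \<Longrightarrow> g t = 0" "0 \<le> a" "\<And>t. 0 \<le> g t"
    and h: "continuous_on {0..} h" "\<And>t. t \<in> {a..b} \<Longrightarrow> c \<le> h t"
  shows "c * (LINT t|lborel. g t) \<le> (LINT t|lborel. g t * h t)"
proof -
  have int: "integrable lborel (\<lambda>t. g t * h t)" if "continuous_on {0..} h" for h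
    by (rule compact_support_times_continuous_integrable[OF continuous_on_smooth_fun[OF g(1)] g(2,3) that])
  have "(LINT t|lborel. g t * c) \<le> (LINT t|lborel. g t * h t)"
  proof (rule integral_mono)
    show "g t * c \<le> g t * h t" for t
      using g(2)[of t] g(4)[of t] h(2)[of t]
      by (cases "t \<in> {a..b}") (auto intro: mult_left_mono)
  qed (rule int[OF continuous_on_const] int[OF h(1)])+
  then show ?thesis by (simp add: mult.commute)
qed

lemma time_cutoff:
  "\<exists>\<theta>::real \<Rightarrow> real. smooth_fun \<theta> \<and> (\<forall>t. t \<notin> {1..2} \<longrightarrow> \<theta> t = 0) \<and> (\<forall>t. 0 \<le> \<theta> t) \<and>
    0 < (LINT t|lborel. \<theta> t)"
proof -
  \<comment> \<open>\<open>4 t - 6\<close> maps \<open>[1, 2]\<close> onto the support \<open>[-2, 2]\<close> of the bump\<close>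
  define \<theta> where "\<theta> t = bump (4 * t + (- 6))" for t
  have smooth: "smooth_fun \<theta>"
    unfolding \<theta>_def by (rule smooth_fun_real_affine[OF smooth_fun_bump])
  have supp: "\<theta> t = 0" if "t \<notin> {1..2}" for t
    unfolding \<theta>_def using that by (intro bump_eq_0) auto
  have nonneg: "0 \<le> \<theta> t" for t by (simp add: \<theta>_def bump_nonneg)
  have "(LINT t|lborel. indicator {5/4..7/4::real} t) \<le> (LINT t|lborel. \<theta> t)"
  proof (rule integral_mono)
    show "integrable lborel \<theta>"
      using compact_support_times_continuous_integrable[OF continuous_on_smooth_fun[OF smooth] supp
          _ continuous_on_const[of _ 1]] by simp
    show "indicator {5/4..7/4} t \<le> \<theta> t" for t :: real
      unfolding \<theta>_def using bump_ge_1[of "4 * t + (- 6)"] bump_nonneg[of "4 * t + (- 6)"]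
      by (auto simp: indicator_def)
    show "integrable lborel (indicator {5/4..7/4::real} :: real \<Rightarrow> real)"
      using borel_integrable_atLeastAtMost'[of "5/4" "7/4" "\<lambda>_. 1::real"]
      by (simp add: set_integrable_def)
  qed
  then have "0 < (LINT t|lborel. \<theta> t)" by simp
  with smooth supp nonneg show ?thesis by blast
qed

section \<open>A bound for persistent flux\<close>

lemma weighted_flux_lower_bound:
  fixes w :: "real \<Rightarrow> real"
  assumes f: "f \<in> L2" and g: "g \<in> L2" and \<gamma>: "\<gamma> \<le> 0"
    and w: "w \<in> borel_measurable lborel" "\<And>x. \<bar>w x\<bar> \<le> K"
    and le: "\<And>x. c * (indicator S x - \<epsilon>) \<le> w x" and S: "S \<in> sets lborel" and c: "0 \<le> c"
  shows "c * ((LINT x:S|lborel. flux \<gamma> f g x) - \<epsilon> * (LINT x|lborel. flux \<gamma> f g x))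
    \<le> (LINT x|lborel. w x * flux \<gamma> f g x)"
proof -
  note int = flux_integrable[OF f g, of \<gamma>]
  have intS: "integrable lborel (\<lambda>x. indicator S x *\<^sub>R flux \<gamma> f g x)"
    using integrable_mult_indicator[OF S int] .
  have "c * ((LINT x:S|lborel. flux \<gamma> f g x) - \<epsilon> * (LINT x|lborel. flux \<gamma> f g x)) =
      (LINT x|lborel. c * (indicator S x *\<^sub>R flux \<gamma> f g x - \<epsilon> * flux \<gamma> f g x))"
    using int intS by (simp add: set_lebesgue_integral_def)
  also have "\<dots> \<le> (LINT x|lborel. w x * flux \<gamma> f g x)"
  proof (rule integral_mono)
    show "integrable lborel (\<lambda>x. c * (indicator S x *\<^sub>R flux \<gamma> f g x - \<epsilon> * flux \<gamma> f g x))"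
      using int intS by (intro integrable_mult_right Bochner_Integration.integrable_diff)
    show "integrable lborel (\<lambda>x. w x * flux \<gamma> f g x)"
      by (rule flux_weight_integral(1)[OF f g w])
    show "c * (indicator S x *\<^sub>R flux \<gamma> f g x - \<epsilon> * flux \<gamma> f g x) \<le> w x * flux \<gamma> f g x" for x
      using mult_right_mono[OF le[of x] flux_nonneg[OF \<gamma>, of f g x]]
      by (simp add: algebra_simps)
  qed
  finally show ?thesis .
qed

text \<open>
  The quantitative core.  The weight \<open>W(x / l)\<close> is tested against the time cutoff \<open>\<theta>(t / T)\<close>, where \<open>W\<close>
  decreases so slowly, at a rate \<open>\<epsilon>\<close> depending on \<open>\<delta>\<close> and on the a priori bound, that the flux far out
  costs at most half of what the window contributes.  Then the flux term of the virial identity is at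
  least a multiple of \<open>T / l\<close>.  The derivative of the time cutoff contributes \<open>O(l^(1/2))\<close>, the \<open>L\<^sup>2\<close> norm
  of the rescaled weight, and the dispersive term \<open>O(T l^(-5/2))\<close>.  Dividing by \<open>T / l\<close> gives the claim.
\<close>

lemma persistent_flux_bound:
  assumes u: "continuous_into_H1 {0..} u" and v: "continuous_into_H1 {0..} v"
    and kdv: "kdv_eq \<gamma> u v" and \<gamma>: "\<gamma> \<le> 0"
    and M: "\<And>t. 0 \<le> t \<Longrightarrow> H1_norm (u t) + H1_norm (v t) \<le> M"
    and \<delta>: "0 < \<delta>"
  obtains K where "\<And>T l. 0 < T \<Longrightarrow> 0 < l \<Longrightarrow>
    (\<And>t. t \<in> {T..2 * T} \<Longrightarrow> \<delta> \<le> (LINT x:{-l..l}|lborel. flux \<gamma> (u t) (v t) x)) \<Longrightarrow>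
    1 \<le> K * (l * sqrt l / T + 1 / (l * sqrt l))"
proof -
  define N where "N = (1 / 2 - \<gamma>) * M\<^sup>2"
  have N: "0 \<le> N" using \<gamma> by (simp add: N_def)
  define \<epsilon> where "\<epsilon> = \<delta> / (2 * (N + 1))"
  have \<epsilon>: "0 < \<epsilon>" "\<epsilon> * N \<le> \<delta> / 2"
    using \<delta> N by (auto simp: \<epsilon>_def field_simps)
  obtain W R where W: "smooth_fun W" "\<And>x. x \<notin> {-R..R} \<Longrightarrow> W x = 0"
    "\<And>x. indicator {-1..1} x - \<epsilon> \<le> deriv W x"
    using slowly_decreasing_cutoff[OF \<epsilon>(1)] by blast
  obtain \<theta> :: "real \<Rightarrow> real" where *: "smooth_fun \<theta>" "\<forall>t. t \<notin> {1..2} \<longrightarrow> \<theta> t = 0" "\<forall>t. 0 \<le> \<theta> t"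
    "0 < (LINT t|lborel. \<theta> t)"
    using time_cutoff by blast
  then have \<theta>: "smooth_fun \<theta>" "\<And>t. t \<notin> {1..2} \<Longrightarrow> \<theta> t = 0" "\<And>t. 0 \<le> \<theta> t"
    "0 < (LINT t|lborel. \<theta> t)"
    by blast+
  note W1 = smooth_fun_deriv[OF W(1)] and W2 = smooth_fun_deriv[OF smooth_fun_deriv[OF W(1)]]
  note W3 = smooth_fun_deriv[OF W2]
  have W1_0: "x \<notin> {-R..R} \<Longrightarrow> deriv W x = 0" for x by (rule deriv_eq_0_outside[OF W(1,2)])
  have W2_0: "x \<notin> {-R..R} \<Longrightarrow> deriv (deriv W) x = 0" for x by (rule deriv_eq_0_outside[OF W1 W1_0])
  have W3_0: "x \<notin> {-R..R} \<Longrightarrow> deriv (deriv (deriv W)) x = 0" for x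
    by (rule deriv_eq_0_outside[OF W2 W2_0])
  have \<theta>1_0: "t \<notin> {1..2} \<Longrightarrow> deriv \<theta> t = 0" for t by (rule deriv_eq_0_outside[OF \<theta>(1,2)])
  have M0: "0 \<le> M"
    using M[of 0] L2_size_le_H1_norm[of "u 0"] L2_size_le_H1_norm[of "v 0"]
      L2_size_nonneg[of "u 0"] L2_size_nonneg[of "v 0"] by linarith
  define m k a b where "m = (LINT t|lborel. \<theta> t)" and "k = (LINT t|lborel. \<bar>deriv \<theta> t\<bar>)"
    and "a = L2_size W" and "b = L2_size (deriv (deriv (deriv W)))"
  have nonneg: "0 < m" "0 \<le> k" "0 \<le> a" "0 \<le> b"
    using \<theta>(4) by (auto simp: m_def k_def a_def b_def L2_size_nonneg integral_nonneg_AE)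
  define K where "K = 2 * k * a * M / (m * \<delta>) + 2 * b * M / \<delta>"
  show thesis
  proof (rule that[of K])
    fix T l :: real
    assume T: "0 < T" and l: "0 < l"
      and large: "\<And>t. t \<in> {T..2 * T} \<Longrightarrow> \<delta> \<le> (LINT x:{-l..l}|lborel. flux \<gamma> (u t) (v t) x)"
    define f g where "f x = 1 * W (1 / l * x)" and "g t = 1 * \<theta> (1 / T * t)" for x t
    have f: "smooth_fun f" and g: "smooth_fun g"
      unfolding f_def g_def by (intro smooth_fun_rescale W(1) \<theta>(1))+
    have f_0: "x \<notin> {l * (-R)..l * R} \<Longrightarrow> f x = 0" for x
      unfolding f_def by (rule support_rescale[OF W(2) l])
    have g_0: "t \<notin> {T * 1..T * 2} \<Longrightarrow> g t = 0" for t
      unfolding g_def by (rule support_rescale[OF \<theta>(2) T])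
    have f': "deriv f = (\<lambda>x. 1 / l * deriv W (1 / l * x))"
      and f''': "deriv (deriv (deriv f)) = (\<lambda>x. (1 / l * (1 / l) * (1 / l)) * deriv (deriv (deriv W)) (1 / l * x))"
      and g': "deriv g = (\<lambda>t. 1 / T * deriv \<theta> (1 / T * t))"
      unfolding f_def g_def by (simp_all only: deriv_rescale W(1) W1 W2 \<theta>(1)) (simp_all only: mult_1)
    have f1_0: "x \<notin> {l * (-R)..l * R} \<Longrightarrow> deriv f x = 0" for x
      unfolding f' by (rule support_rescale[OF W1_0 l])
    have f3_0: "x \<notin> {l * (-R)..l * R} \<Longrightarrow> deriv (deriv (deriv f)) x = 0" for x
      unfolding f''' by (rule support_rescale[OF W3_0 l])
    have g1_0: "t \<notin> {T * 1..T * 2} \<Longrightarrow> deriv g t = 0" for t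
      unfolding g' by (rule support_rescale[OF \<theta>1_0 T])
    note f1 = smooth_fun_deriv[OF f] and f3 = smooth_fun_deriv[OF smooth_fun_deriv[OF smooth_fun_deriv[OF f]]]
    have fL2: "f \<in> L2" "deriv (deriv (deriv f)) \<in> L2"
      using compact_support_L2[OF f f_0] compact_support_L2[OF f3 f3_0] by auto
    have size: "L2_size f = sqrt l * a"
      "L2_size (deriv (deriv (deriv f))) = sqrt l / (l * l * l) * b"
      unfolding f''' f_def a_def b_def using l
      by (simp_all only: L2_size_rescale zero_less_divide_1_iff) (simp_all add: real_sqrt_divide)
    have g_int: "(LINT t|lborel. g t) = T * m" "(LINT t|lborel. \<bar>g t\<bar>) = T * m"
      using integral_rescale[of "1 / T" \<theta>] T \<theta>(3) by (simp_all add: g_def m_def)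
    have g'_int: "(LINT t|lborel. \<bar>deriv g t\<bar>) = k"
      using integral_rescale[of "1 / T" "\<lambda>t. \<bar>deriv \<theta> t\<bar>"] T by (simp add: g' k_def abs_mult)
    have pairing: "\<bar>LINT x|lborel. h x * v t x\<bar> \<le> L2_size h * M" if "h \<in> L2" "0 \<le> t" for h t
    proof -
      have "L2_size (v t) \<le> M"
        using M[OF that(2)] L2_size_le_H1_norm[of "v t"] L2_size_le_H1_norm[of "u t"]
          L2_size_nonneg[of "u t"] by linarith
      then have "L2_size h * L2_size (v t) \<le> L2_size h * M"
        by (intro mult_left_mono L2_size_nonneg)
      with L2_pairing_bound[OF that(1) continuous_into_H1_L2[OF v that(2)]] show ?thesis by linarith
    qed
    have time: "0 < T * 1" "0 \<le> T * 1" using T by simp_all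
    have identity: "(LINT t|lborel. g t * (LINT x|lborel. deriv f x * flux \<gamma> (u t) (v t) x)) =
        - (LINT t|lborel. deriv g t * (LINT x|lborel. f x * v t x))
        - (LINT t|lborel. g t * (LINT x|lborel. deriv (deriv (deriv f)) x * v t x))"
      by (rule virial_identity[OF u v kdv f f_0 g g_0 time(1)])
    have transport: "\<bar>LINT t|lborel. deriv g t * (LINT x|lborel. f x * v t x)\<bar> \<le> (sqrt l * a * M) * k"
      using weighted_time_integral_bound[OF smooth_fun_deriv[OF g] g1_0 time(2)
          continuous_on_L2_pairing[OF v fL2(1)] pairing[OF fL2(1)]]
      by (simp add: size g'_int)
    have dispersion: "\<bar>LINT t|lborel. g t * (LINT x|lborel. deriv (deriv (deriv f)) x * v t x)\<bar>
        \<le> (sqrt l / (l * l * l) * b * M) * (T * m)"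
      using weighted_time_integral_bound[OF g g_0 time(2)
          continuous_on_L2_pairing[OF v fL2(2)] pairing[OF fL2(2)]]
      by (simp only: size g_int)
    obtain B where B: "\<And>x. \<bar>deriv f x\<bar> \<le> B"
      using smooth_fun_compact_support_bounded[OF f1 f1_0] by blast
    have f1_meas: "deriv f \<in> borel_measurable lborel"
      using borel_measurable_smooth_fun[OF f1] by simp
    have flux_t: "(LINT x|lborel. deriv f x * flux \<gamma> (u t) (v t) x) =
        (LINT x|lborel. deriv f x * (norm (v t x))\<^sup>2) / 2 - \<gamma> * (LINT x|lborel. deriv f x * (norm (u t x))\<^sup>2)"
      if "0 \<le> t" for t
      using flux_weight_integral(2)[OF continuous_into_H1_L2[OF u that]
          continuous_into_H1_L2[OF v that] f1_meas B] .
    have flux_cont: "continuous_on {0..} (\<lambda>t. LINT x|lborel. deriv f x * flux \<gamma> (u t) (v t) x)"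
    proof (rule continuous_on_eq)
      show "continuous_on {0..} (\<lambda>t. (LINT x|lborel. deriv f x * (norm (v t x))\<^sup>2) / 2
          - \<gamma> * (LINT x|lborel. deriv f x * (norm (u t x))\<^sup>2))"
        using continuous_on_weighted_square[OF u f1_meas B] continuous_on_weighted_square[OF v f1_meas B]
        by (intro continuous_on_diff continuous_on_divide continuous_on_mult continuous_on_const) auto
    qed (simp add: flux_t)
    have "1 / l * (\<delta> / 2) \<le> (LINT x|lborel. deriv f x * flux \<gamma> (u t) (v t) x)"
      if t: "t \<in> {T * 1..T * 2}" for t
    proof -
      have t0: "0 \<le> t" using t T by (auto intro: order_trans[of 0 T])
      note L2 = continuous_into_H1_L2[OF u t0] continuous_into_H1_L2[OF v t0]
      have "\<epsilon> * (LINT x|lborel. flux \<gamma> (u t) (v t) x) \<le> \<epsilon> * N"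
        using \<epsilon>(1) flux_integral_le[OF L2 \<gamma> M[OF t0]] unfolding N_def by (intro mult_left_mono) auto
      moreover have "\<delta> \<le> (LINT x:{-l..l}|lborel. flux \<gamma> (u t) (v t) x)"
        using t by (intro large) (auto simp: mult.commute)
      ultimately have "\<delta> / 2 \<le> (LINT x:{-l..l}|lborel. flux \<gamma> (u t) (v t) x)
          - \<epsilon> * (LINT x|lborel. flux \<gamma> (u t) (v t) x)"
        using \<epsilon>(2) by linarith
      then have "1 / l * (\<delta> / 2) \<le> 1 / l * ((LINT x:{-l..l}|lborel. flux \<gamma> (u t) (v t) x)
          - \<epsilon> * (LINT x|lborel. flux \<gamma> (u t) (v t) x))"
        using l by (intro mult_left_mono) auto
      also have "\<dots> \<le> (LINT x|lborel. deriv f x * flux \<gamma> (u t) (v t) x)"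
      proof (rule weighted_flux_lower_bound[OF L2 \<gamma> f1_meas B])
        fix x
        have "indicator {-l..l} x = (indicator {-1..1} (1 / l * x) :: real)"
          using l by (auto simp: indicator_def field_simps)
        then show "1 / l * (indicator {-l..l} x - \<epsilon>) \<le> deriv f x"
          unfolding f' using W(3)[of "1 / l * x"] l by (intro mult_left_mono) auto
      qed (use l in auto)
      finally show ?thesis .
    qed
    then have "1 / l * (\<delta> / 2) * (LINT t|lborel. g t) \<le>
        (LINT t|lborel. g t * (LINT x|lborel. deriv f x * flux \<gamma> (u t) (v t) x))"
      using \<theta>(3) by (intro weighted_time_integral_lower_bound[OF g g_0 time(2) _ flux_cont]) (auto simp: g_def)
    also have "\<dots> \<le> (sqrt l * a * M) * k + (sqrt l / (l * l * l) * b * M) * (T * m)"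
      using identity transport dispersion by linarith
    finally have main: "1 / l * (\<delta> / 2) * (T * m) \<le>
        (sqrt l * a * M) * k + (sqrt l / (l * l * l) * b * M) * (T * m)"
      unfolding g_int .
    \<comment> \<open>the factor that turns the left-hand side into \<open>1\<close>\<close>
    define q where "q = 2 * l / (T * m * \<delta>)"
    have "0 \<le> q" using l T nonneg \<delta> by (simp add: q_def)
    have "1 = q * (1 / l * (\<delta> / 2) * (T * m))"
      using l T nonneg(1) \<delta> by (simp add: q_def)
    also have "\<dots> \<le> q * ((sqrt l * a * M) * k + (sqrt l / (l * l * l) * b * M) * (T * m))"
      using main \<open>0 \<le> q\<close> by (rule mult_left_mono)
    also have "\<dots> = 2 * k * a * M / (m * \<delta>) * (l * sqrt l / T) + 2 * b * M / \<delta> * (sqrt l / (l * l))"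
      using l T nonneg(1) \<delta> by (simp add: q_def field_simps)
    also have "sqrt l / (l * l) = 1 / (l * sqrt l)"
      using l by (simp add: field_simps)
    also have "2 * k * a * M / (m * \<delta>) * (l * sqrt l / T) + 2 * b * M / \<delta> * (1 / (l * sqrt l))
        \<le> K * (l * sqrt l / T) + K * (1 / (l * sqrt l))"
      using l T nonneg M0 \<delta> unfolding K_def by (intro add_mono mult_right_mono) auto
    finally show "1 \<le> K * (l * sqrt l / T + 1 / (l * sqrt l))"
      by (simp only: distrib_left)
  qed
qed

section \<open>Decay along a sequence of times\<close>

text \<open>
  This is where the exponent enters: the first term has order \<open>3/2 p - 1\<close> in \<open>T\<close>, which is negative
  exactly for \<open>p < 2/3\<close>, and the second one order \<open>- 3/2 p\<close>.
\<close>

lemma window_scale_tendsto_0: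
  fixes C p :: real
  assumes p: "0 < p" "p < 2/3" and C: "0 < C"
  defines "l \<equiv> \<lambda>T. C * (2 * T) powr p"
  shows "((\<lambda>T. l T * sqrt (l T) / T + 1 / (l T * sqrt (l T))) \<longlongrightarrow> 0) at_top"
proof -
  have top: "filterlim (\<lambda>T::real. 2 * T) at_top at_top"
    by (rule filterlim_tendsto_pos_mult_at_top[OF tendsto_const _ filterlim_ident]) simp
  have "((\<lambda>T. 2 * C powr (3/2) * (2 * T) powr (3/2 * p - 1) + C powr (- (3/2)) * (2 * T) powr (- (3/2 * p)))
      \<longlongrightarrow> 2 * C powr (3/2) * 0 + C powr (- (3/2)) * 0) at_top"
    using p by (intro tendsto_intros tendsto_neg_powr top) auto
  moreover have "\<forall>\<^sub>F T in at_top.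
      2 * C powr (3/2) * (2 * T) powr (3/2 * p - 1) + C powr (- (3/2)) * (2 * T) powr (- (3/2 * p)) =
      l T * sqrt (l T) / T + 1 / (l T * sqrt (l T))"
    using eventually_gt_at_top[of 0]
  proof eventually_elim
    case (elim T)
    have lT: "0 < l T" using C elim by (simp add: l_def)
    have "l T * sqrt (l T) = l T powr 1 * l T powr (1/2)"
      using lT by (simp add: powr_half_sqrt)
    also have "\<dots> = l T powr (3/2)" by (simp only: powr_add[symmetric]) simp
    also have "\<dots> = C powr (3/2) * (2 * T) powr (3/2 * p)"
      using C elim by (simp add: l_def powr_mult powr_powr mult.commute)
    finally have "l T * sqrt (l T) = C powr (3/2) * (2 * T) powr (3/2 * p)" .
    moreover define c X where "c = C powr (3/2)" and "X = (2 * T) powr (3/2 * p)"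
    ultimately have l: "l T * sqrt (l T) = c * X" by simp
    have "(2 * T) powr (3/2 * p - 1) = X / (2 * T)" "(2 * T) powr (- (3/2 * p)) = 1 / X"
      "C powr (- (3/2)) = 1 / c"
      unfolding c_def X_def powr_diff powr_minus_divide using elim by simp_all
    then show ?case
      by (simp only: l flip: c_def) simp
  qed
  ultimately show ?thesis
    using Lim_transform_eventually by fastforce
qed

lemma Omega_eq: "Omega C p t = {- (C * t powr p)..C * t powr p}"
  by (auto simp: Omega_def)

text \<open>
  On the time interval \<open>[T, 2 T]\<close> all the growing windows lie in the largest one, of half-width
  \<open>l = C (2 T)\<^sup>p\<close>, so a weight that does not depend on time suffices.
\<close>

lemma flux_not_persistent:
  assumes u: "continuous_into_H1 {0..} u" and v: "continuous_into_H1 {0..} v"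
    and kdv: "kdv_eq \<gamma> u v" and \<gamma>: "\<gamma> \<le> 0"
    and M: "\<And>t. 0 \<le> t \<Longrightarrow> H1_norm (u t) + H1_norm (v t) \<le> M"
    and p: "0 < p" "p < 2/3" and C: "0 < C" and \<delta>: "0 < \<delta>"
  shows "\<not> (\<forall>\<^sub>F t in at_top. \<delta> \<le> (LINT x:Omega C p t|lborel. flux \<gamma> (u t) (v t) x))"
proof
  assume "\<forall>\<^sub>F t in at_top. \<delta> \<le> (LINT x:Omega C p t|lborel. flux \<gamma> (u t) (v t) x)"
  then obtain T0 where T0: "\<And>t. T0 \<le> t \<Longrightarrow> \<delta> \<le> (LINT x:Omega C p t|lborel. flux \<gamma> (u t) (v t) x)"
    by (auto simp: eventually_at_top_linorder)
  define l where "l T = C * (2 * T) powr p" for T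
  obtain K where K: "\<And>T l. 0 < T \<Longrightarrow> 0 < l \<Longrightarrow>
      (\<And>t. t \<in> {T..2 * T} \<Longrightarrow> \<delta> \<le> (LINT x:{-l..l}|lborel. flux \<gamma> (u t) (v t) x)) \<Longrightarrow>
      1 \<le> K * (l * sqrt l / T + 1 / (l * sqrt l))"
    using persistent_flux_bound[OF u v kdv \<gamma> M \<delta>] by metis
  have "\<forall>\<^sub>F T in at_top. 1 \<le> K * (l T * sqrt (l T) / T + 1 / (l T * sqrt (l T)))"
    using eventually_ge_at_top[of "max 1 T0"]
  proof eventually_elim
    case (elim T)
    show ?case
    proof (rule K)
      show "0 < T" using elim by simp
      then show "0 < l T" using C by (simp add: l_def)
      fix t assume t: "t \<in> {T..2 * T}"
      with elim have t0: "0 \<le> t" "T0 \<le> t" by auto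
      note int = flux_integrable[OF continuous_into_H1_L2[OF u t0(1)] continuous_into_H1_L2[OF v t0(1)], of \<gamma>]
      have "C * t powr p \<le> l T"
        unfolding l_def using t t0 C p by (intro mult_left_mono powr_mono2) auto
      then have sub: "Omega C p t \<subseteq> {- l T..l T}" by (auto simp: Omega_eq)
      have "\<delta> \<le> (LINT x:Omega C p t|lborel. flux \<gamma> (u t) (v t) x)"
        by (rule T0[OF t0(2)])
      also have "\<dots> \<le> (LINT x:{- l T..l T}|lborel. flux \<gamma> (u t) (v t) x)"
        unfolding set_lebesgue_integral_def
      proof (rule integral_mono)
        show "indicator (Omega C p t) x *\<^sub>R flux \<gamma> (u t) (v t) x
            \<le> indicator {- l T..l T} x *\<^sub>R flux \<gamma> (u t) (v t) x" for x
          using sub flux_nonneg[OF \<gamma>, of "u t" "v t" x] by (auto simp: indicator_def)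
        show "integrable lborel (\<lambda>x. indicator (Omega C p t) x *\<^sub>R flux \<gamma> (u t) (v t) x)"
          by (intro integrable_mult_indicator int) (simp add: Omega_eq)
        show "integrable lborel (\<lambda>x. indicator {- l T..l T} x *\<^sub>R flux \<gamma> (u t) (v t) x)"
          by (intro integrable_mult_indicator int) simp
      qed
      finally show "\<delta> \<le> (LINT x:{- l T..l T}|lborel. flux \<gamma> (u t) (v t) x)" .
    qed
  qed
  moreover have "((\<lambda>T. K * (l T * sqrt (l T) / T + 1 / (l T * sqrt (l T)))) \<longlongrightarrow> K * 0) at_top"
    unfolding l_def by (intro tendsto_mult tendsto_const window_scale_tendsto_0 p C)
  ultimately have "1 \<le> K * 0"
    by (intro tendsto_lowerbound) auto
  then show False by simp
qed

lemma Liminf_eq_0: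
  fixes h :: "real \<Rightarrow> real"
  assumes "\<And>t. 0 \<le> h t" "\<And>\<delta>. 0 < \<delta> \<Longrightarrow> \<not> (\<forall>\<^sub>F t in at_top. \<delta> \<le> h t)"
  shows "Liminf at_top (\<lambda>t. ereal (h t)) = 0"
proof (rule antisym)
  show "0 \<le> Liminf at_top (\<lambda>t. ereal (h t))"
    using assms(1) by (intro Liminf_bounded always_eventually) simp
  show "Liminf at_top (\<lambda>t. ereal (h t)) \<le> 0"
  proof (rule ccontr)
    assume "\<not> Liminf at_top (\<lambda>t. ereal (h t)) \<le> 0"
    then obtain \<delta> where \<delta>: "0 < ereal \<delta>" "ereal \<delta> < Liminf at_top (\<lambda>t. ereal (h t))"
      using ereal_dense2[of 0] by (auto simp: not_le)
    from less_LiminfD[OF \<delta>(2)] have "\<forall>\<^sub>F t in at_top. \<delta> \<le> h t"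
      by eventually_elim simp
    then show False using assms(2) \<delta>(1) by simp
  qed
qed

theorem theorem2p1:
  fixes \<alpha> \<beta> \<gamma> p\<^sub>1 C :: real
    and u0 :: "real \<Rightarrow> complex" and v0 :: "real \<Rightarrow> real"
    and u :: "real \<Rightarrow> real \<Rightarrow> complex" and v :: "real \<Rightarrow> real \<Rightarrow> real"
  assumes "\<alpha> < 0" and "\<gamma> < 0"
    and "u0 \<in> H1" and "v0 \<in> H1"
    and "global_solution \<alpha> \<beta> \<gamma> u0 v0 u v"
    and "0 < p\<^sub>1" and "p\<^sub>1 < 2/3" and "C > 0"
  shows "Liminf at_top (\<lambda>t. ereal (LINT x:Omega C p\<^sub>1 t|lborel. (v t x)\<^sup>2)) = 0 \<and>
         Liminf at_top (\<lambda>t. ereal (LINT x:Omega C p\<^sub>1 t|lborel. (cmod (u t x))\<^sup>2)) = 0"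
proof -
  have u: "continuous_into_H1 {0..} u" and v: "continuous_into_H1 {0..} v" and kdv: "kdv_eq \<gamma> u v"
    using assms(5) by (auto simp: global_solution_def)
  obtain M where M: "\<And>t. 0 \<le> t \<Longrightarrow> H1_norm (u t) + H1_norm (v t) \<le> M"
    using assms(5) by (auto simp: global_solution_def)
  note not_persistent = flux_not_persistent[OF u v kdv less_imp_le[OF \<open>\<gamma> < 0\<close>] M
      \<open>0 < p\<^sub>1\<close> \<open>p\<^sub>1 < 2/3\<close> \<open>C > 0\<close>]
  have dominated: "\<not> (\<forall>\<^sub>F t in at_top. \<delta> \<le> (LINT x:Omega C p\<^sub>1 t|lborel. h t x))"
    if \<delta>: "0 < \<delta>" and c: "0 < c"
      and int: "\<And>t. 0 \<le> t \<Longrightarrow> integrable lborel (h t)"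
      and le: "\<And>t x. c * h t x \<le> flux \<gamma> (u t) (v t) x" for \<delta> c and h :: "real \<Rightarrow> real \<Rightarrow> real"
  proof
    assume "\<forall>\<^sub>F t in at_top. \<delta> \<le> (LINT x:Omega C p\<^sub>1 t|lborel. h t x)"
    then have "\<forall>\<^sub>F t in at_top. c * \<delta> \<le> (LINT x:Omega C p\<^sub>1 t|lborel. flux \<gamma> (u t) (v t) x)"
      using eventually_ge_at_top[of 0]
    proof eventually_elim
      case (elim t)
      have "c * \<delta> \<le> c * (LINT x:Omega C p\<^sub>1 t|lborel. h t x)"
        using elim c by simp
      also have "\<dots> = (LINT x:Omega C p\<^sub>1 t|lborel. c * h t x)" by simp
      also have "\<dots> \<le> (LINT x:Omega C p\<^sub>1 t|lborel. flux \<gamma> (u t) (v t) x)"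
      proof (rule set_integral_mono)
        show "set_integrable lborel (Omega C p\<^sub>1 t) (\<lambda>x. c * h t x)"
          unfolding set_integrable_def
          by (intro integrable_mult_indicator integrable_mult_right int elim) (simp add: Omega_eq)
        show "set_integrable lborel (Omega C p\<^sub>1 t) (flux \<gamma> (u t) (v t))"
          unfolding set_integrable_def
          by (intro integrable_mult_indicator flux_integrable continuous_into_H1_L2[OF u]
              continuous_into_H1_L2[OF v] elim) (simp add: Omega_eq)
      qed (rule le)
      finally show ?case .
    qed
    then show False using not_persistent[of "c * \<delta>"] \<delta> c by simp
  qed
  have int: "integrable lborel (\<lambda>x. (v t x)\<^sup>2)" "integrable lborel (\<lambda>x. (cmod (u t x))\<^sup>2)"
    if "0 \<le> t" for t
    using L2_integrable[OF continuous_into_H1_L2[OF v that]]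
      L2_integrable[OF continuous_into_H1_L2[OF u that]] by simp_all
  have "1 / 2 * (v t x)\<^sup>2 \<le> flux \<gamma> (u t) (v t) x" "- \<gamma> * (cmod (u t x))\<^sup>2 \<le> flux \<gamma> (u t) (v t) x"
    for t x
    using mult_nonpos_nonneg[of \<gamma> "(cmod (u t x))\<^sup>2"] zero_le_power2[of "v t x"] \<open>\<gamma> < 0\<close>
    unfolding flux_def by (simp_all add: less_imp_le)
  note le = this
  show ?thesis
  proof (intro conjI Liminf_eq_0)
    show "0 \<le> (LINT x:Omega C p\<^sub>1 t|lborel. (v t x)\<^sup>2)" "0 \<le> (LINT x:Omega C p\<^sub>1 t|lborel. (cmod (u t x))\<^sup>2)" for t
      by (simp_all add: set_lebesgue_integral_def integral_nonneg_AE)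
    show "\<not> (\<forall>\<^sub>F t in at_top. \<delta> \<le> (LINT x:Omega C p\<^sub>1 t|lborel. (v t x)\<^sup>2))" if "0 < \<delta>" for \<delta>
      by (rule dominated[OF that _ int(1) le(1)]) simp
    show "\<not> (\<forall>\<^sub>F t in at_top. \<delta> \<le> (LINT x:Omega C p\<^sub>1 t|lborel. (cmod (u t x))\<^sup>2))" if "0 < \<delta>" for \<delta>
      by (rule dominated[OF that _ int(2) le(2)]) (use \<open>\<gamma> < 0\<close> in simp)
  qed
qed

end
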